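(* For every $n\in\mathbb{N}$ (positive integers), $\mathcal{A}^{*}_n \subseteq \mathcal{A}_n$. Here $\mathcal{A}_n^*$ is the convex hull of the vectors $v(G)$, $G\in\mathcal{G}_n$, and $\mathcal{A}_n$ is the closure of the set of all win vectors $\boldsymbol{wv}(\boldsymbol{T},P)$ with $\boldsymbol{T}$ a symmetric and honest $n$-player tournament and $P\in\mathcal{D}_n$.
   Context: Write $[n]=\{1,\dots,n\}$ for the set of players. Let $\mathcal{M}_n=\{P=(p_{ij})\in[0,1]^{n\times n}: P+P^T=\mathbf{1}\}$, where $\mathbf{1}$ is the all-ones matrix (so $p_{ij}+p_{ji}=1$ and $p_{ii}=\frac12$). A matrix $P\in\mathcal{M}_n$ is doubly monotonic if $p_{ij}$ is (weakly) decreasing in $i$ and (weakly) increasing in $j$; $\mathcal{D}_n$ is the set of doubly monotonic $P\in\mathcal{M}_n$. An $n$-player tournament $\boldsymbol{T}$ is a set of rules (a randomized algorithm) which, one match at a time, announces an unordered pair $\{i,j\}$ of distinct players who then play a match, receives as only information which of the two won (no draws), and eventually announces one of the $n$ players as tournament winner. The choice of the next pair, and of the winner, may depend on the results of earlier matches and on additional randomness. The number of matches is bounded by a constant depending only on $\boldsymbol{T}$. For $P\in\mathcal{M}_n$, the specialization $(\boldsymbol{T},P)$ is the random process in which every match between $i$ and $j$ is won by $i$ with probability $p_{ij}$, independently of the past; $\pi_i(P)$ is the probability that player $i$ wins the tournament, and $\boldsymbol{wv}(\boldsymbol{T},P)=(\pi_1(P),\dots,\pi_n(P))$. Symmetric: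 for every $P\in\mathcal{M}_n$, every permutation $\sigma$ of $[n]$ and every $i\in[n]$, $\pi_i(P)=\pi_{\sigma(i)}(Q)$, where $Q\in\mathcal{M}_n$ is defined by $q_{\sigma(i)\sigma(j)}=p_{ij}$. Honest: for every possible state of $\boldsymbol{T}$ in which $r\ge0$ matches have been played and a pair $\{i,j\}$ has just been announced for match $r+1$ (the state includes the results of the previous matches and all random choices already made by the rules), and every $P\in\mathcal{M}_n$, one has $\pi_i^+(P)\ge\pi_i^-(P)$, where $\pi_i^+(P)$ (resp. $\pi_i^-(P)$) is the probability that $i$ wins the tournament conditioned on the current state and on $i$ winning (resp. losing) match $r+1$, with all subsequent matches decided according to $P$. $\mathcal{G}_n$ is the family of labelled digraphs (loops and multiple arcs allowed) on vertex set $\{1,\dots,n\}$ such that: (Rule 1) exactly two arcs go out from each vertex; (Rule 2) every arc $(i,j)$ (from $i$ to $j$) satisfies $j\le i$; (Rule 3) if $(i,j_1)$ and $(i,j_2)$ are the two outgoing arcs from $i$ and $j_1=j_2$, then $j_1=1$ or $j_1=i$. For $G\in\mathcal{G}_n$, $v(G)=(v_1,\dots,v_n)\in\mathbb{R}^n$ is given by $v_i=\frac{\mathrm{indeg}_G(i)}{2n}$, where each loop at $i$ counts once in the indegree of $i$. *)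

theory Defs
  imports "HOL-Probability.Probability" "Graph_Theory.Digraph"
begin

text \<open>
  The players \<open>1, \<dots>, n\<close> are the elements of a finite linearly ordered type \<open>'n\<close> with
  \<open>n = CARD('n)\<close>; \<open>Min UNIV\<close> plays the role of player (or vertex) 1.
\<close>

subsection \<open>Matrices of winning probabilities\<close>

definition win_matrices :: "(real ^ 'n ^ 'n) set" where
  "win_matrices =
     {P. (\<forall>i j. P $ i $ j \<in> {0..1}) \<and> P + transpose P = (\<chi> i j. 1)}"

definition doubly_monotonic :: "((real, 'n) vec, 'n::{finite,linorder}) vec set" where
  "doubly_monotonic =
     {P \<in> win_matrices. (\<forall>j. antimono (\<lambda>i. P $ i $ j)) \<and> (\<forall>i. mono (\<lambda>j. P $ i $ j))}"

subsection \<open>Tournaments\<close>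

text \<open>
  The rules, as a decision tree.  \<open>Play i j A B\<close> announces the pair \<open>{i, j}\<close> and continues with
  \<open>A\<close> if \<open>i\<close> wins the match and with \<open>B\<close> if \<open>j\<close> wins; \<open>Choose D\<close> continues with rules drawn
  at random from \<open>D\<close>.
\<close>

datatype 'n rules =
    Announce_Winner 'n
  | Play 'n 'n "'n rules" "'n rules"
  | Choose "'n rules pmf"

text \<open>
  Since \<open>Choose\<close> may branch infinitely, well-foundedness of the tree alone does not bound the
  number of matches.
\<close>

inductive plays_at_most :: "nat \<Rightarrow> 'n rules \<Rightarrow> bool" where
  "plays_at_most N (Announce_Winner k)"
| "i \<noteq> j \<Longrightarrow> plays_at_most N A \<Longrightarrow> plays_at_most N B \<Longrightarrow> plays_at_most (Suc N) (Play i j A B)"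
| "(\<And>A. A \<in> set_pmf D \<Longrightarrow> plays_at_most N A) \<Longrightarrow> plays_at_most N (Choose D)"

definition tournament :: "'n rules \<Rightarrow> bool" where
  "tournament T \<longleftrightarrow> (\<exists>N. plays_at_most N T)"

text \<open>Law of the announced winner when matches are decided according to \<open>P\<close>.\<close>

primrec winner_pmf :: "real ^ 'n ^ 'n \<Rightarrow> 'n rules \<Rightarrow> 'n pmf" where
  "winner_pmf P (Announce_Winner k) = return_pmf k"
| "winner_pmf P (Play i j A B) =
     bind_pmf (bernoulli_pmf (P $ i $ j)) (\<lambda>b. if b then winner_pmf P A else winner_pmf P B)"
| "winner_pmf P (Choose D) = join_pmf (map_pmf (winner_pmf P) D)"

definition win_prob :: "'n rules \<Rightarrow> real ^ 'n ^ 'n \<Rightarrow> 'n \<Rightarrow> real" where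
  "win_prob T P i = pmf (winner_pmf P T) i"

definition win_vector :: "'n rules \<Rightarrow> real ^ 'n ^ 'n \<Rightarrow> real ^ 'n" where
  "win_vector T P = (\<chi> i. win_prob T P i)"

definition symmetric_tournament :: "'n::finite rules \<Rightarrow> bool" where
  "symmetric_tournament T \<longleftrightarrow>
     (\<forall>P \<in> win_matrices. \<forall>Q \<in> win_matrices. \<forall>\<sigma>. bij \<sigma> \<longrightarrow>
        (\<forall>i j. Q $ \<sigma> i $ \<sigma> j = P $ i $ j) \<longrightarrow>
        (\<forall>i. win_prob T P i = win_prob T Q (\<sigma> i)))"

text \<open>
  \<open>state T S\<close>: in some run of \<open>T\<close>, the rules remaining after some results and random choices
  are \<open>S\<close>.  Both results of every match are possible, since the matrix \<open>P\<close> is not part of the rules.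
\<close>

inductive state :: "'n rules \<Rightarrow> 'n rules \<Rightarrow> bool" for T where
  "state T T"
| "state T (Play i j A B) \<Longrightarrow> state T A"
| "state T (Play i j A B) \<Longrightarrow> state T B"
| "state T (Choose D) \<Longrightarrow> A \<in> set_pmf D \<Longrightarrow> state T A"

text \<open>
  Conditioning on the current state and on the result of the announced match amounts to
  restarting the process from the corresponding subtree.
\<close>

definition honest :: "'n::finite rules \<Rightarrow> bool" where
  "honest T \<longleftrightarrow>
     (\<forall>i j A B. state T (Play i j A B) \<longrightarrow>
        (\<forall>P \<in> win_matrices. win_prob A P i \<ge> win_prob B P i \<and> win_prob B P j \<ge> win_prob A P j))"

definition achievable :: "(real ^ 'n::{finite,linorder}) set" where
  "achievable =
     closure {win_vector T P | T P.
       tournament T \<and> symmetric_tournament T \<and> honest T \<and> P \<in> doubly_monotonic}"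

subsection \<open>Digraphs with two arcs out of every vertex\<close>

text \<open>Arcs are named by natural numbers; a finite digraph needs no other names.\<close>

definition two_out_digraphs :: "('n::{finite,linorder}, nat) pre_digraph set" where
  "two_out_digraphs =
     {G. fin_digraph G \<and> verts G = UNIV \<and>
         (\<forall>i. out_degree G i = 2) \<and>
         (\<forall>e \<in> arcs G. head G e \<le> tail G e) \<and>
         (\<forall>i. \<forall>e \<in> out_arcs G i. \<forall>e' \<in> out_arcs G i.
            e \<noteq> e' \<longrightarrow> head G e = head G e' \<longrightarrow> head G e = Min UNIV \<or> head G e = i)}"

definition digraph_vector :: "('n::finite, nat) pre_digraph \<Rightarrow> real ^ 'n" where
  "digraph_vector G = (\<chi> i. real (in_degree G i) / (2 * real CARD('n)))"

definition digraph_hull :: "(real ^ 'n::{finite,linorder}) set" where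
  "digraph_hull = convex hull (digraph_vector ` two_out_digraphs)"

end

theory Submission
  imports Defs
begin

text \<open>
  All digraph vectors are approximated with one and the same doubly monotonic matrix
  \<open>p\<^sub>i\<^sub>j = 1/2 + \<delta> w(i, j)\<close>; the win vectors of fair tournaments at a fixed matrix form a convex set,
  so this suffices.  Every pair of players meets \<open>N\<close> times, and rounding the score differences yields
  an integer matrix \<open>u\<close> that equals \<open>w\<close> up to relabeling with probability tending to 1.  The winner is
  then drawn from the uniform distribution, corrected by moving mass \<open>t\<^sub>i\<^sub>j/(2n)\<close> from \<open>i\<close> to \<open>j\<close> for all
  \<open>i \<noteq> j\<close>.  Here \<open>t\<^sub>i\<^sub>j\<close> is the largest number of arcs from \<open>\<sigma> i\<close> to \<open>\<sigma> j\<close>, over all labelings \<open>\<sigma>\<close> for which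
  the results look like those of \<open>\<sigma>\<close>, except that \<open>j\<close> may have done better and \<open>i\<close> worse.  So
  \<open>t\<^sub>i\<^sub>j\<close> increases with the results of \<open>j\<close> and decreases with those of \<open>i\<close>, which is honesty.

  At \<open>u = w\<close> the number \<open>t\<^sub>i\<^sub>j\<close> is the number of arcs from \<open>i\<close> to \<open>j\<close>, which gives the digraph vector.  What
  remains is that no player gives away more than it has, i.e. \<open>\<Sum>\<^sub>j t\<^sub>i\<^sub>j \<le> 2\<close> for every \<open>u\<close>: three players
  receiving mass from \<open>i\<close>, or one receiving two units and another one, see each other's results, so that
  their labelings agree and exhibit three arcs out of one vertex.
\<close>

subsection \<open>A generic doubly monotonic weight\<close>

text \<open>Since \<open>y < n\<close>, the number \<open>n * (n - x) + y\<close> encodes the pair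
  lexicographically, a smaller \<open>x\<close> counting more. Doubling and adding 1 makes every
  off-diagonal weight odd, so that half a weight lies midway between two consecutive integers; the
  later rounding of scores relies on this.\<close>

definition weight :: "nat \<Rightarrow> nat \<Rightarrow> nat \<Rightarrow> int" where
  "weight n x y =
     (if x < y then 2 * (int n * (int n - int x) + int y) + 1
      else if y < x then - (2 * (int n * (int n - int y) + int x) + 1) else 0)"

lemma weight_swap: "weight n y x = - weight n x y"
  by (auto simp: weight_def)

lemma weight_self [simp]: "weight n x x = 0"
  by (simp add: weight_def)

lemma weight_pos:
  assumes "x < n" "x < y"
  shows "weight n x y > 0"
proof -
  have "int n * (int n - int x) \<ge> 0" using assms by simp
  then show ?thesis using assms by (simp add: weight_def)
qed

lemma weight_pos_iff:
  assumes "x < n" "y < n"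
  shows "0 < weight n x y \<longleftrightarrow> x < y"
  using weight_pos[of x n y] weight_pos[of y n x] weight_swap[of n x y] assms
  by (cases x y rule: linorder_cases) auto

text \<open>
  Positive weights are ordered lexicographically, first by the better and then by the worse player.
  The case of four players below depends on this choice; in all other cases a strictly monotonic
  weight with distinct values would do.
\<close>

lemma weight_less_lex:
  assumes "x < y" "x' < y'" "y < n" "y' < n" "x' < x \<or> x' = x \<and> y < y'"
  shows "weight n x y < weight n x' y'"
  using assms(5)
proof
  assume "x' < x"
  then have "int n * (int n - int x') \<ge> int n * (int n - int x + 1)"
    by (intro mult_left_mono) auto
  then have "int n * (int n - int x') \<ge> int n * (int n - int x) + int n"
    by (simp add: algebra_simps)
  then show ?thesis using assms by (simp add: weight_def)
next
  assume "x' = x \<and> y < y'"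
  then show ?thesis using assms by (simp add: weight_def)
qed

lemma weight_le_lex:
  assumes "x < y" "x' < y'" "y < n" "y' < n"
  shows "weight n x y \<le> weight n x' y' \<longleftrightarrow> x' < x \<or> x' = x \<and> y \<le> y'"
  using weight_less_lex[OF assms] weight_less_lex[OF assms(2,1,4,3)]
  by (metis linorder_not_less nat_less_le linorder_neqE_nat order_refl less_le_not_le)

lemma weight_inj:
  assumes "weight n x y = weight n x' y'" "x \<noteq> y" "x < n" "y < n" "x' < n" "y' < n"
  shows "x = x' \<and> y = y'"
proof -
  have a: "x < y \<longleftrightarrow> x' < y'" and b: "y < x \<longleftrightarrow> y' < x'"
    using assms weight_pos_iff weight_swap by metis+
  show ?thesis
  proof (cases "x < y")
    case True
    then show ?thesis using weight_le_lex[of x y x' y' n] weight_le_lex[of x' y' x y n] a assms by auto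
  next
    case False
    then have "y < x" "y' < x'" using b assms by auto
    moreover have "weight n y x = weight n y' x'" using assms(1) weight_swap by metis
    ultimately show ?thesis
      using weight_le_lex[of y x y' x' n] weight_le_lex[of y' x' y x n] assms by auto
  qed
qed

lemma weight_strict_antimono:
  assumes "x < y" "y < n" "k < n"
  shows "weight n y k < weight n x k"
proof -
  consider "k < x" | "k = x" | "x < k" "k < y" | "k = y" | "y < k" by linarith
  then show ?thesis
  proof cases
    case 1 then show ?thesis
      using weight_less_lex[of k x k y n] assms weight_swap[of n k x] weight_swap[of n k y] by simp
  next
    case 2 then show ?thesis using weight_pos[of x n y] assms weight_swap[of n x y] by simp
  next
    case 3 then show ?thesis
      using weight_pos[of x n k] weight_pos[of k n y] assms weight_swap[of n k y] by simp
  next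
    case 4 then show ?thesis using weight_pos[of x n y] assms by simp
  next
    case 5 then show ?thesis using weight_less_lex[of y k x k n] assms by simp
  qed
qed

lemma weight_le_cancel:
  assumes "weight n x k \<le> weight n y k" "x < n" "y < n" "k < n"
  shows "y \<le> x"
  using weight_strict_antimono[of x y n k] assms by (meson leD leI)

lemma weight_le_swap: "weight n x y \<le> weight n x' y' \<longleftrightarrow> weight n y' x' \<le> weight n y x"
  by (metis neg_le_iff_le weight_swap)

lemma weight_le_neg:
  assumes "weight n x y \<le> weight n x' y'" "y' < x'" "x < n" "y < n" "x' < n"
  shows "y < x"
  using assms weight_pos[of y' n x'] weight_pos_iff[of y n x] by (subst (asm) weight_le_swap) auto

text \<open>
  With four players \<open>i, a, b, c\<close> two labelings share only one player besides \<open>i\<close>, so their agreement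
  needs a separate argument.  In the next two lemmas \<open>ab\<close> is the label that \<open>b\<close> gets in the labeling
  belonging to \<open>a\<close>, in which \<open>a\<close> and \<open>i\<close> have the labels \<open>sa\<close> and \<open>ra\<close>, and so on.
\<close>

lemma weight_four_cyclic:
  assumes "distinct [ba,bc,sb,rb]" "{ba,bc,sb,rb} \<subseteq> {..<4}" "sb < rb"
    and "distinct [ca,cb,sc,rc]" "{ca,cb,sc,rc} \<subseteq> {..<4}" "sc < rc"
    and le1: "weight 4 sb ba \<le> weight 4 cb ca"
    and le2: "weight 4 sc cb \<le> weight 4 ac ab"
    and "ca < cb" "bc < ba" "ab < ac" "ab < 4" "ac < 4"
  shows False
proof -
  have n: "ca < 4" "cb < 4" "sc < 4" "rc < 4" "ba < 4" "bc < 4" "sb < 4" "rb < 4"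
    using assms(2,5) by auto
  have "ba < sb" "cb < sc"
    using weight_le_neg[OF le1] weight_le_neg[OF le2] assms(9-13) n by auto
  \<comment> \<open>Four strictly increasing labels below 4 must be 0, 1, 2, 3; this applies to
    \<open>ca < cb < sc < rc\<close> and to \<open>bc < ba < sb < rb\<close>. Then
    \<open>le1\<close> reads \<open>weight 4 2 1 \<le> weight 4 1 0\<close>, that is, -29 \<le>
    -35.\<close>
  then have "ca = 0" "cb = 1" "ba = 1" "sb = 2" using assms(1,3,4,6,9,10) n by auto
  then show False using le1 by (simp add: weight_def)
qed

lemma weight_four_transitive:
  assumes a: "distinct [ab,ac,sa,ra]" "{ab,ac,sa,ra} \<subseteq> {..<4}" "sa < ra"
    and b: "distinct [ba,bc,sb,rb]" "{ba,bc,sb,rb} \<subseteq> {..<4}" "sb < rb"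
    and c: "distinct [ca,cb,sc,rc]" "{ca,cb,sc,rc} \<subseteq> {..<4}" "sc < rc"
    and le: "weight 4 sa ab \<le> weight 4 ca cb" "weight 4 sa ac \<le> weight 4 ba bc"
      "weight 4 sb ba \<le> weight 4 cb ca"
      "weight 4 sc ca \<le> weight 4 bc ba" "weight 4 sc cb \<le> weight 4 ac ab"
    and lt: "ca < cb" "ba < bc" "ab < ac"
  shows "ab = cb \<and> ac = bc \<and> ba = ca"
proof -
  have n: "ca < 4" "cb < 4" "sc < 4" "rc < 4" "ba < 4" "bc < 4" "sb < 4" "rb < 4"
     "ab < 4" "ac < 4" "sa < 4" "ra < 4"
    using a(2) b(2) c(2) by auto
  have neg: "ba < sb" "ca < sc" "cb < sc"
    using weight_le_neg[OF le(3)] weight_le_neg[OF le(4)] weight_le_neg[OF le(5)] lt n by auto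
  then have 1: "ca = 0" "cb = 1" "sc = 2" using c lt n by auto
  \<comment> \<open>\<open>ba\<close> is below the three other labels of its labeling, hence
    0.\<close>
  have "bc \<noteq> sb" "bc \<noteq> rb" using b by auto
  with neg(1) b(3) lt(2) n(6,8) have 2: "ba = 0" by presburger
  have "1 \<le> ab"
    using le(5) 1 lt(3) n weight_le_lex[of ab ac 1 2 4] weight_le_swap[of 4 2 1] by auto
  moreover have "bc \<le> 2"
    using le(4) 1 2 lt(2) n weight_le_lex[of 0 bc 0 2 4] weight_le_swap[of 4 2 0] by auto
  \<comment> \<open>Some label must be 0; \<open>ab\<close> and \<open>ac\<close> are positive and
    \<open>ra\<close> exceeds \<open>sa\<close>, which leaves \<open>sa\<close>. Now the comparisons
    in \<open>le(1)\<close> and \<open>le(2)\<close> share the best player 0, so they order the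
    worse players.\<close>
  moreover have sa: "sa = 0" using a n lt(3) \<open>1 \<le> ab\<close> by auto
  then have "ab \<le> 1" "ac \<le> bc"
    using le(1,2) 1 2 weight_le_lex[of 0 ab 0 1 4] weight_le_lex[of 0 ac 0 bc 4] calculation(1) lt n
    by auto
  ultimately show ?thesis using 1 2 lt by auto
qed

section \<open>The weight on an arbitrary finite linear order\<close>

definition position :: "'n::{finite,linorder} \<Rightarrow> nat" where
  "position x = card {..<x}"

lemma position_less_card: "position (x::'n::{finite,linorder}) < CARD('n)"
  unfolding position_def by (rule psubset_card_mono) auto

lemma strict_mono_position: "strict_mono (position :: 'n::{finite,linorder} \<Rightarrow> nat)"
  unfolding strict_mono_def position_def by (auto intro!: psubset_card_mono)

lemma position_less_iff [simp]: "position x < position y \<longleftrightarrow> x < y"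
  using strict_mono_less[OF strict_mono_position] .

lemma position_le_iff [simp]: "position x \<le> position y \<longleftrightarrow> x \<le> y"
  using strict_mono_less_eq[OF strict_mono_position] .

lemma position_eq_iff [simp]: "position x = position y \<longleftrightarrow> x = y"
  using strict_mono_eq[OF strict_mono_position] .

definition wt :: "'n::{finite,linorder} \<Rightarrow> 'n \<Rightarrow> int" where
  "wt x y = weight CARD('n) (position x) (position y)"

lemma wt_swap: "wt y x = - wt x y"
  unfolding wt_def by (rule weight_swap)

lemma wt_pos_iff: "0 < wt x y \<longleftrightarrow> x < y"
  unfolding wt_def by (simp add: weight_pos_iff position_less_card)

lemma wt_inj: "wt x y = wt x' y' \<Longrightarrow> x \<noteq> y \<Longrightarrow> x = x' \<and> y = y'"
  unfolding wt_def using weight_inj[OF _ _ position_less_card position_less_card position_less_card position_less_card]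
  by (metis position_eq_iff)

lemma wt_le_iff:
  "x < y \<Longrightarrow> x' < y' \<Longrightarrow> wt x y \<le> wt x' y' \<longleftrightarrow> x' < x \<or> x' = x \<and> y \<le> y'"
  unfolding wt_def by (subst weight_le_lex) (auto simp: position_less_card)

lemma wt_le_cancel: "wt x k \<le> wt y k \<longleftrightarrow> y \<le> x"
  unfolding wt_def
  using weight_le_cancel[OF _ position_less_card position_less_card position_less_card]
    weight_strict_antimono[OF _ position_less_card position_less_card]
  by (metis order_le_less position_le_iff position_less_iff position_eq_iff)

lemma wt_le_cancel2: "wt k x \<le> wt k y \<longleftrightarrow> x \<le> y"
  using wt_le_cancel[of y k x] wt_swap[of k x] wt_swap[of k y] by simp

lemma wt_le_swap: "wt (x::'n::{finite,linorder}) y \<le> wt (x'::'n) y' \<longleftrightarrow> wt y' x' \<le> wt y x"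
  unfolding wt_def by (rule weight_le_swap)

section \<open>Labelings compatible with the results\<close>

definition skew :: "('n \<Rightarrow> 'n \<Rightarrow> int) \<Rightarrow> bool" where
  "skew u \<longleftrightarrow> (\<forall>a b. u b a = - u a b)"

text \<open>
  \<open>dominates u i j \<sigma>\<close> is the largest condition that holds when \<open>u\<close> comes from the labeling \<open>\<sigma>\<close> and that
  is preserved when \<open>j\<close> wins more or \<open>i\<close> wins less.
\<close>

definition dominates :: "('n::{finite,linorder} \<Rightarrow> 'n \<Rightarrow> int) \<Rightarrow> 'n \<Rightarrow> 'n \<Rightarrow> ('n \<Rightarrow> 'n) \<Rightarrow> bool" where
  "dominates u i j \<sigma> \<longleftrightarrow> bij \<sigma> \<and>
     (\<forall>a b. a \<notin> {i, j} \<longrightarrow> b \<notin> {i, j} \<longrightarrow> u a b = wt (\<sigma> a) (\<sigma> b)) \<and>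
     (\<forall>b. wt (\<sigma> j) (\<sigma> b) \<le> u j b) \<and> (\<forall>b. u i b \<le> wt (\<sigma> i) (\<sigma> b))"

lemma dominates_bij: "dominates u i j \<sigma> \<Longrightarrow> bij \<sigma>"
  and dominates_eq: "dominates u i j \<sigma> \<Longrightarrow> a \<notin> {i, j} \<Longrightarrow> b \<notin> {i, j} \<Longrightarrow> u a b = wt (\<sigma> a) (\<sigma> b)"
  and dominates_ge: "dominates u i j \<sigma> \<Longrightarrow> wt (\<sigma> j) (\<sigma> b) \<le> u j b"
  and dominates_le: "dominates u i j \<sigma> \<Longrightarrow> u i b \<le> wt (\<sigma> i) (\<sigma> b)"
  by (auto simp: dominates_def)

lemma dominates_eq_iff: "dominates u i j \<sigma> \<Longrightarrow> \<sigma> a = \<sigma> b \<longleftrightarrow> a = b"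
  by (meson bij_def dominates_bij inj_eq)

section \<open>Agreement of labelings with a common source\<close>

context
  fixes u :: "'n::{finite,linorder} \<Rightarrow> 'n \<Rightarrow> int" and i a b c :: 'n and A B C :: "'n \<Rightarrow> 'n"
  assumes dist: "distinct [i, a, b, c]"
    and dom: "dominates u i a A" "dominates u i b B" "dominates u i c C"
    and less: "A a < A i" "B b < B i" "C c < C i"
begin

lemma dominates_four_transitive:
  assumes card: "CARD('n) = 4" and pos: "u a b > 0" "u a c > 0" "u b c > 0"
  shows "A b = C b \<and> A c = B c \<and> B a = C a"
proof -
  note r = position_less_card[where ?'n = 'n, unfolded card]
  \<comment> \<open>Each labeling reproduces exactly one of the three results among
    \<open>a\<close>, \<open>b\<close>, \<open>c\<close>: the one not involving its own
    receiver.\<close>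
  have eq: "u a b = wt (C a) (C b)" "u a c = wt (B a) (B c)" "u b c = wt (A b) (A c)"
    "u b a = wt (C b) (C a)" "u c a = wt (B c) (B a)" "u c b = wt (A c) (A b)"
    using dist by (auto intro!: dominates_eq[OF dom(1)] dominates_eq[OF dom(2)] dominates_eq[OF dom(3)])
  have lt: "C a < C b" "B a < B c" "A b < A c"
    using pos unfolding eq wt_pos_iff by auto
  note ge = dominates_ge[OF dom(1), of b] dominates_ge[OF dom(1), of c] dominates_ge[OF dom(2), of a]
    dominates_ge[OF dom(3), of a] dominates_ge[OF dom(3), of b]
  have "position (A b) = position (C b) \<and> position (A c) = position (B c) \<and> position (B a) = position (C a)"
    by (rule weight_four_transitive[of _ _ "position (A a)" "position (A i)" _ _ "position (B b)" "position (B i)"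
          _ _ "position (C c)" "position (C i)"])
      (use ge[unfolded eq wt_def card] lt less dist r in \<open>auto simp: dominates_eq_iff[OF dom(1)]
         dominates_eq_iff[OF dom(2)] dominates_eq_iff[OF dom(3)]\<close>)
  then show ?thesis by simp
qed

lemma dominates_four_not_cyclic:
  assumes card: "CARD('n) = 4" and pos: "u a b > 0" "u c a > 0" "u b c > 0"
  shows False
proof -
  note r = position_less_card[where ?'n = 'n, unfolded card]
  have eq: "u a b = wt (C a) (C b)" "u a c = wt (B a) (B c)" "u b c = wt (A b) (A c)"
    "u b a = wt (C b) (C a)" "u c a = wt (B c) (B a)" "u c b = wt (A c) (A b)"
    using dist by (auto intro!: dominates_eq[OF dom(1)] dominates_eq[OF dom(2)] dominates_eq[OF dom(3)])
  have lt: "C a < C b" "B c < B a" "A b < A c"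
    using pos unfolding eq wt_pos_iff by auto
  note ge = dominates_ge[OF dom(2), of a] dominates_ge[OF dom(3), of b]
  show False
    by (rule weight_four_cyclic[of "position (B a)" "position (B c)" "position (B b)" "position (B i)"
          "position (C a)" "position (C b)" "position (C c)" "position (C i)" "position (A c)" "position (A b)"])
      (use ge[unfolded eq wt_def card] lt less dist r in \<open>auto simp: dominates_eq_iff[OF dom(1)]
         dominates_eq_iff[OF dom(2)] dominates_eq_iff[OF dom(3)]\<close>)
qed

end

text \<open>The results among \<open>a\<close>, \<open>b\<close>, \<open>c\<close> are nonzero and
  orient a triangle. Six of the eight orientations are transitive and reduce to one by permuting the
  roles of the players; the two cyclic ones are impossible.\<close>

lemma dominates_agree_four:
  fixes u :: "'n::{finite,linorder} \<Rightarrow> 'n \<Rightarrow> int"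
  assumes dist: "distinct [i, a, b, c]" and card: "CARD('n) = 4" and u: "skew u"
    and dom: "dominates u i a A" "dominates u i b B" "dominates u i c C"
    and less: "A a < A i" "B b < B i" "C c < C i"
  shows "A c = B c"
proof -
  have nz: "u x y \<noteq> 0" if "dominates u i z Z" "x \<notin> {i, z}" "y \<notin> {i, z}" "x \<noteq> y" for x y z Z
    using dominates_eq[OF that(1-3)] dominates_eq_iff[OF that(1), of x y] that(4) wt_inj[of "Z x" "Z y" "Z x" "Z x"]
      wt_swap[of "Z x" "Z x"] by auto
  have sk: "u y x = - u x y" for x y using u unfolding skew_def by blast
  have "u a b > 0 \<or> u b a > 0" "u a c > 0 \<or> u c a > 0" "u b c > 0 \<or> u c b > 0"
    using nz[OF dom(1), of b c] nz[OF dom(2), of a c] nz[OF dom(3), of a b] dist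
      sk[of a b] sk[of b c] sk[of a c] by auto
  then consider "u a b > 0" "u b c > 0" "u a c > 0" | "u a b > 0" "u b c > 0" "u c a > 0"
    | "u a b > 0" "u c b > 0" "u a c > 0" | "u a b > 0" "u c b > 0" "u c a > 0"
    | "u b a > 0" "u b c > 0" "u a c > 0" | "u b a > 0" "u b c > 0" "u c a > 0"
    | "u b a > 0" "u c b > 0" "u a c > 0" | "u b a > 0" "u c b > 0" "u c a > 0"
    by blast
  then show ?thesis
  proof cases
    case 1 then show ?thesis
      using dominates_four_transitive[of i a b c u A B C] assms by auto
  next
    case 2 then show ?thesis
      using dominates_four_not_cyclic[of i a b c u A B C] assms by auto
  next
    case 3 then show ?thesis
      using dominates_four_transitive[of i a c b u A C B] assms by auto
  next
    case 4 then show ?thesis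
      using dominates_four_transitive[of i c a b u C A B] assms by auto
  next
    case 5 then show ?thesis
      using dominates_four_transitive[of i b a c u B A C] assms by auto
  next
    case 6 then show ?thesis
      using dominates_four_transitive[of i b c a u B C A] assms by auto
  next
    case 7 then show ?thesis
      using dominates_four_not_cyclic[of i a c b u A C B] assms by auto
  next
    case 8 then show ?thesis
      using dominates_four_transitive[of i c b a u C B A] assms by auto
  qed
qed

text \<open>If \<open>x\<close> exists and there are not exactly four players, a fifth player
  \<open>y\<close> exists. Both labelings reproduce \<open>u x y\<close> exactly, and a nonzero
  weight determines its pair of labels.\<close>

lemma dominates_agree:
  fixes u :: "'n::{finite,linorder} \<Rightarrow> 'n \<Rightarrow> int"
  assumes card: "CARD('n) \<noteq> 4"
    and dom: "dominates u i a A" "dominates u i b B" and x: "x \<notin> {i, a, b}" and ne: "i \<noteq> a" "i \<noteq> b" "a \<noteq> b"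
  shows "A x = B x"
proof -
  have "card {i, a, b, x} = 4" using assms by auto
  moreover have "card {i, a, b, x} \<le> CARD('n)" by (intro card_mono) auto
  ultimately have "{i, a, b, x} \<noteq> UNIV" using card by metis
  then obtain y where y: "y \<notin> {i, a, b, x}" by auto
  have "wt (A x) (A y) = wt (B x) (B y)"
    using dominates_eq[OF dom(1), of x y] dominates_eq[OF dom(2), of x y] x y by simp
  then show ?thesis using wt_inj dominates_eq_iff[OF dom(1), of x y] y by auto
qed

lemma bij_agree_image:
  assumes "bij A" "bij B" "\<And>x. x \<notin> S \<Longrightarrow> A x = B x"
  shows "A ` S = B ` S"
proof -
  have "A ` (- S) = B ` (- S)" using assms(3) by auto
  then show ?thesis using assms(1,2) by (metis bij_image_Compl_eq double_complement)
qed

text \<open>Outside \<open>i\<close>, \<open>a\<close>, \<open>b\<close> the labelings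
  \<open>A\<close> and \<open>B\<close> agree, so they use the same three labels inside. Comparing
  with \<open>c\<close> and excluding the labels above the receivers leaves only
  \<open>A = B\<close> there as well. Applied to all pairs of labelings, this exhibits three
  different arcs out of one vertex.\<close>

lemma dominates_three_agree:
  fixes u :: "'n::{finite,linorder} \<Rightarrow> 'n \<Rightarrow> int"
  assumes dist: "distinct [i, a, b, c]" and u: "skew u"
    and dom: "dominates u i a A" "dominates u i b B" "dominates u i c C"
    and less: "A a < A i" "B b < B i" "C c < C i"
  shows "A i = B i \<and> B a = A a \<and> A a \<noteq> B b"
proof -
  have eq: "X x = Y x" if "x \<notin> {i, p, q}" "distinct [i, p, q, r]"
    "dominates u i p X" "dominates u i q Y" "dominates u i r Z" "X p < X i" "Y q < Y i" "Z r < Z i"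
    for x p q r X Y Z
  proof (cases "CARD('n) = 4")
    case True
    have "card {i, p, q, r} = 4" using that(2) by auto
    then have "{i, p, q, r} = UNIV" using True by (metis card_subset_eq finite subset_UNIV)
    then have "x = r" using that(1) by blast
    then show ?thesis using dominates_agree_four[OF that(2) True u that(3-8)] by simp
  next
    case False
    show ?thesis by (rule dominates_agree[OF False that(3,4,1)]) (use that(2) in auto)
  qed
  have AB: "A x = B x" if "x \<notin> {i, a, b}" for x
    by (rule eq[of x a b c A B C]) (use that dom less dist in auto)
  have Ac: "A b = C b" by (rule eq[of b a c b A C B]) (use dom less dist in auto)
  have Bc: "B a = C a" by (rule eq[of a b c a B C A]) (use dom less dist in auto)
  have c: "A c = B c" using AB dist by auto
  \<comment> \<open>Player \<open>c\<close> has the same label in both. The result of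
    \<open>a\<close> against \<open>c\<close> is exact for \<open>B\<close> and only a lower bound
    for \<open>A\<close>, so \<open>a\<close> ranks at least as well in \<open>B\<close>;
    symmetrically for \<open>b\<close>.\<close>
  have le: "B a \<le> A a" "A b \<le> B b"
    using dominates_ge[OF dom(1), of c] dominates_eq[OF dom(2), of a c]
      dominates_ge[OF dom(2), of c] dominates_eq[OF dom(1), of b c] dist c
    by (auto simp: wt_le_cancel)
  \<comment> \<open>Only here does the third labeling enter directly: both labels are labels of
    \<open>C\<close>, for different players.\<close>
  have ne: "B a \<noteq> A b" unfolding Ac Bc using dominates_eq_iff[OF dom(3)] dist by auto
  have im: "A ` {i, a, b} = B ` {i, a, b}"
    using AB dom by (intro bij_agree_image) (auto intro: dominates_bij)
  have "B a \<in> A ` {i, a, b}" unfolding im by auto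
  then have 1: "B a = A a" using ne le less by auto
  have "A b \<in> B ` {i, a, b}" unfolding im[symmetric] by auto
  then have 2: "A b = B b" using ne le less by auto
  have "A i \<in> B ` {i, a, b}" unfolding im[symmetric] by auto
  moreover have "A i \<noteq> A a" "A i \<noteq> A b" using dominates_eq_iff[OF dom(1)] dist by auto
  ultimately show ?thesis using 1 2 ne by auto
qed

text \<open>This serves the case of a double arc, which by Rule 3 ends in vertex 1 unless it is a
  loop. The two receivers see their mutual result from both sides, and the lexicographic order then
  forces \<open>j\<close> to have the best label in \<open>B\<close> too.\<close>

lemma dominates_Min_agree:
  fixes u :: "'n::{finite,linorder} \<Rightarrow> 'n \<Rightarrow> int"
  assumes dist: "distinct [i, j, k]" and u: "skew u"
    and dom: "dominates u i j A" "dominates u i k B"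
    and Min: "A j = Min UNIV" and less: "B k < B i"
  shows "B i = A i \<and> B k = A k"
proof -
  have sk: "u y x = - u x y" for x y using u unfolding skew_def by blast
  have min: "A j \<le> x" for x using Min by simp
  have inj: "A x = A y \<longleftrightarrow> x = y" "B x = B y \<longleftrightarrow> x = y" for x y
    using dominates_eq_iff dom by blast+
  have lt: "A j < A k" using min[of "A k"] inj dist by (auto simp: order_le_less)
  \<comment> \<open>\<open>u j k\<close> lies between the two: \<open>j\<close> did at least as well
    as \<open>A\<close> predicts, and \<open>k\<close> at least as well as \<open>B\<close>
    predicts.\<close>
  have "wt (A j) (A k) \<le> wt (B j) (B k)"
    using dominates_ge[OF dom(1), of k] dominates_ge[OF dom(2), of j] sk[of j k] wt_swap[of "B k" "B j"]
    by linarith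
  moreover from this have "B j < B k" using lt wt_pos_iff[of "A j" "A k"] wt_pos_iff[of "B j" "B k"] by linarith
  ultimately have j: "B j = A j" and k: "A k \<le> B k"
    using wt_le_iff[OF lt, of "B j" "B k"] min[of "B j"] by auto
  have m: "B m = A m" if "m \<notin> {i, j, k}" for m
  proof (cases "CARD('n) = 4")
    case False
    show ?thesis
      by (rule dominates_agree[OF False dom, symmetric]) (use that dist in auto)
  next
    case True
    have "card {i, j, k, m} = 4" using that dist by auto
    then have U: "UNIV = {i, j, k, m}" using True by (metis card_subset_eq finite subset_UNIV)
    have "x = j" if "x \<notin> {i, k, m}" for x
    proof -
      have "x \<in> {i, j, k, m}" unfolding U[symmetric] by simp
      then show ?thesis using that by blast
    qed
    then have im: "A ` {i, k, m} = B ` {i, k, m}"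
      using j by (intro bij_agree_image[OF dominates_bij[OF dom(1)] dominates_bij[OF dom(2)]]) metis
    have le: "A m \<le> B m"
      using dominates_ge[OF dom(1), of m] dominates_eq[OF dom(2), of j m] that dist j
      by (auto simp: wt_le_cancel2)
    have wle: "wt (B k) (B m) \<le> wt (A k) (A m)"
      using dominates_ge[OF dom(2), of m] dominates_eq[OF dom(1), of k m] that dist by auto
    \<comment> \<open>If \<open>B m = A k\<close>, then \<open>B k\<close> can only be
      \<open>A i\<close> and \<open>B i\<close> is \<open>A m\<close>, against \<open>less\<close>.
      If \<open>B m = A i\<close>, then \<open>B k = A k\<close>, and \<open>wle\<close> gives
      \<open>B m \<le> A m\<close>, against \<open>le\<close>.\<close>
    have "B m \<in> A ` {i, k, m}" "B k \<in> A ` {i, k, m}" "B i \<in> A ` {i, k, m}" unfolding im by auto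
    moreover have "B k \<noteq> B m" "B i \<noteq> B m" using inj that by auto
    ultimately show ?thesis using le k less wle by (auto simp: wt_le_cancel2)
  qed
  have im: "A ` {i, k} = B ` {i, k}"
    using m j by (intro bij_agree_image[OF dominates_bij[OF dom(1)] dominates_bij[OF dom(2)]])
      (metis insert_iff)
  have "B k \<in> A ` {i, k}" "B i \<in> A ` {i, k}" unfolding im by auto
  then show ?thesis using k less by auto
qed

text \<open>With a fourth player, exact entries fix the label of every third player. With exactly
  three players, the permutations moving the third one are excluded one by one. What remains
  permutes \<open>i\<close> and \<open>j\<close>, and \<open>less\<close> rules out the
  swap.\<close>

lemma dominates_wt:
  fixes i j :: "'n::{finite,linorder}"
  assumes dom: "dominates wt i j \<sigma>" and less: "\<sigma> j < \<sigma> i"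
  shows "\<sigma> i = i \<and> \<sigma> j = j"
proof -
  have inj: "\<sigma> x = \<sigma> y \<longleftrightarrow> x = y" for x y using dominates_eq_iff[OF dom] .
  have pos: "x < y \<Longrightarrow> wt x y \<le> wt x' y' \<Longrightarrow> x' < y'" for x y x' y' :: 'n
    using wt_pos_iff[of x y] wt_pos_iff[of x' y'] by linarith
  have ji: "j < i" using dominates_ge[OF dom, of i] less pos by blast
  have fixed: "\<sigma> k = k" if k: "k \<notin> {i, j}" for k
  proof (cases "UNIV = {i, j, k}")
    case False
    then obtain m where "m \<notin> {i, j, k}" by auto
    then show ?thesis using dominates_eq[OF dom, of k m] k wt_inj[of k m "\<sigma> k" "\<sigma> m"] by auto
  next
    case True
    have le: "wt (\<sigma> j) (\<sigma> k) \<le> wt j k" "wt (\<sigma> k) (\<sigma> i) \<le> wt k i"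
      using dominates_ge[OF dom, of k] dominates_le[OF dom, of k] wt_le_swap by blast+
    have jk: "j < k \<and> (j < \<sigma> j \<or> j = \<sigma> j \<and> \<sigma> k \<le> k)" if "\<sigma> j < \<sigma> k"
      using that le(1) pos wt_le_iff by blast
    have ki: "k < i \<and> (k < \<sigma> k \<or> k = \<sigma> k \<and> \<sigma> i \<le> i)" if "\<sigma> k < \<sigma> i"
      using that le(2) pos wt_le_iff by blast
    have "\<sigma> i \<in> {i, j, k}" "\<sigma> j \<in> {i, j, k}" "\<sigma> k \<in> {i, j, k}"
      using True by blast+
    moreover have "\<sigma> i \<noteq> \<sigma> j" "\<sigma> i \<noteq> \<sigma> k" "\<sigma> j \<noteq> \<sigma> k" "j \<noteq> k" "i \<noteq> k" using inj k ji by auto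
    ultimately consider "\<sigma> k = k" | "\<sigma> k = i" "\<sigma> j = j" "\<sigma> i = k" | "\<sigma> k = i" "\<sigma> j = k" "\<sigma> i = j"
      | "\<sigma> k = j" "\<sigma> j = i" "\<sigma> i = k" | "\<sigma> k = j" "\<sigma> j = k" "\<sigma> i = i"
      unfolding insert_iff empty_iff by metis
    then show ?thesis
    proof cases
      case 2
      then show ?thesis using jk ki ji less \<open>i \<noteq> k\<close> unfolding 2 by (metis leD order_le_less)
    next
      case 3
      then show ?thesis using jk ki ji less \<open>j \<noteq> k\<close> unfolding 3 by (metis order.asym order.strict_trans)
    next
      case 4
      then show ?thesis using jk ki ji less unfolding 4 by (metis order.asym order.strict_trans)
    next
      case 5
      then show ?thesis using jk ki ji less \<open>j \<noteq> k\<close> unfolding 5 by (metis order.asym less_irrefl order.strict_trans)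
    qed
  qed
  have "\<sigma> ` {i, j} = id ` {i, j}"
    using fixed by (intro bij_agree_image[OF dominates_bij[OF dom] bij_id]) auto
  then have "{\<sigma> i, \<sigma> j} = {i, j}" by simp
  then show ?thesis using ji less by (metis doubleton_eq_iff order.asym)
qed

lemma dominates_id: "dominates wt i j id"
  by (simp add: dominates_def)

subsection \<open>Transfers\<close>

definition improves :: "'n \<Rightarrow> ('n \<Rightarrow> 'n \<Rightarrow> int) \<Rightarrow> ('n \<Rightarrow> 'n \<Rightarrow> int) \<Rightarrow> bool" where
  "improves k u u' \<longleftrightarrow> skew u \<and> skew u' \<and>
     (\<forall>a b. a \<noteq> k \<longrightarrow> b \<noteq> k \<longrightarrow> u a b = u' a b) \<and> (\<forall>b. u k b \<le> u' k b)"

lemma dominates_improves_target: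
  assumes "dominates u i j \<sigma>" "improves j u u'" "i \<noteq> j"
  shows "dominates u' i j \<sigma>"
proof -
  have *: "u a b = u' a b" if "a \<noteq> j" "b \<noteq> j" for a b using assms(2) that by (auto simp: improves_def)
  have **: "u j b \<le> u' j b" for b using assms(2) by (auto simp: improves_def)
  have "u' b j \<le> u b j" for b
    using **[of b] assms(2) unfolding improves_def skew_def by (metis neg_le_iff_le)
  then have "u' i b \<le> u i b" for b using *[of i b] assms(3) by (cases "b = j") auto
  then show ?thesis using assms(1) * ** unfolding dominates_def by (metis insertCI order_trans)
qed

lemma dominates_improves_source:
  assumes "dominates u' i j \<sigma>" "improves i u u'" "i \<noteq> j"
  shows "dominates u i j \<sigma>"
proof -
  have *: "u a b = u' a b" if "a \<noteq> i" "b \<noteq> i" for a b using assms(2) that by (auto simp: improves_def)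
  have **: "u i b \<le> u' i b" for b using assms(2) by (auto simp: improves_def)
  have "u' b i \<le> u b i" for b
    using **[of b] assms(2) unfolding improves_def skew_def by (metis neg_le_iff_le)
  then have "u' j b \<le> u j b" for b using *[of j b] assms(3) by (cases "b = i") auto
  then show ?thesis using assms(1) * ** unfolding dominates_def by (metis insertCI order_trans)
qed

lemma dominates_relabel:
  assumes "bij \<tau>"
  shows "dominates (\<lambda>a b. u (\<tau> a) (\<tau> b)) i j (\<sigma> \<circ> \<tau>) \<longleftrightarrow> dominates u (\<tau> i) (\<tau> j) \<sigma>"
proof -
  have "bij (\<sigma> \<circ> \<tau>) \<longleftrightarrow> bij \<sigma>"
    using assms by (metis bij_betw_comp_iff bij_betw_imp_surj_on)
  moreover have all: "(\<forall>b. Q (\<tau> b)) \<longleftrightarrow> (\<forall>b. Q b)" for Q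
    using assms by (metis bij_pointE)
  moreover have "\<tau> a \<in> {\<tau> i, \<tau> j} \<longleftrightarrow> a \<in> {i, j}" for a
    using assms by (auto simp: bij_def inj_eq)
  moreover have "(\<forall>a b. \<tau> a \<notin> {\<tau> i, \<tau> j} \<longrightarrow> \<tau> b \<notin> {\<tau> i, \<tau> j} \<longrightarrow> u (\<tau> a) (\<tau> b) = wt (\<sigma> (\<tau> a)) (\<sigma> (\<tau> b)))
    \<longleftrightarrow> (\<forall>a b. a \<notin> {\<tau> i, \<tau> j} \<longrightarrow> b \<notin> {\<tau> i, \<tau> j} \<longrightarrow> u a b = wt (\<sigma> a) (\<sigma> b))"
    by (subst all[symmetric], subst (2) all[symmetric]) (rule refl)
  ultimately show ?thesis unfolding dominates_def comp_def
    using all[of "\<lambda>b. wt (\<sigma> (\<tau> j)) (\<sigma> b) \<le> u (\<tau> j) b"] all[of "\<lambda>b. u (\<tau> i) b \<le> wt (\<sigma> (\<tau> i)) (\<sigma> b)"]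
    by simp
qed

text \<open>The inserted 0 is the value when no labeling dominates. Loops move no mass, hence the
  value 0 for \<open>i = j\<close>.\<close>

definition transfer :: "('n::{finite,linorder} \<Rightarrow> 'n \<Rightarrow> nat) \<Rightarrow> ('n \<Rightarrow> 'n \<Rightarrow> int) \<Rightarrow> 'n \<Rightarrow> 'n \<Rightarrow> nat" where
  "transfer \<mu> u i j =
     (if i = j then 0 else Max (insert 0 {\<mu> (\<sigma> i) (\<sigma> j) |\<sigma>. dominates u i j \<sigma>}))"

lemma finite_transfer: "finite {\<mu> (\<sigma> i) (\<sigma> j) |\<sigma>. dominates u i j \<sigma>}"
  for u :: "'n::{finite,linorder} \<Rightarrow> 'n \<Rightarrow> int"
  by (rule finite_subset[of _ "range (\<lambda>(a, b). \<mu> a b)"]) auto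

lemma transfer_ge: "i \<noteq> j \<Longrightarrow> dominates u i j \<sigma> \<Longrightarrow> \<mu> (\<sigma> i) (\<sigma> j) \<le> transfer \<mu> u i j"
  unfolding transfer_def by (auto intro!: Max_ge finite.insertI finite_transfer)

lemma transfer_cases:
  obtains "transfer \<mu> u i j = 0"
  | \<sigma> where "i \<noteq> j" "dominates u i j \<sigma>" "transfer \<mu> u i j = \<mu> (\<sigma> i) (\<sigma> j)"
proof (cases "i = j")
  case False
  have "Max (insert 0 {\<mu> (\<sigma> i) (\<sigma> j) |\<sigma>. dominates u i j \<sigma>}) \<in> insert 0 {\<mu> (\<sigma> i) (\<sigma> j) |\<sigma>. dominates u i j \<sigma>}"
    by (intro Max_in finite.insertI finite_transfer) auto
  then show ?thesis using that False by (auto simp: transfer_def)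
qed (use that in \<open>auto simp: transfer_def\<close>)

lemma transfer_improves_target:
  assumes "improves j u u'" shows "transfer \<mu> u i j \<le> transfer \<mu> u' i j"
  by (cases rule: transfer_cases[of \<mu> u i j]) (auto intro!: transfer_ge dominates_improves_target[OF _ assms])

lemma transfer_improves_source:
  assumes "improves i u u'" shows "transfer \<mu> u' i j \<le> transfer \<mu> u i j"
  by (cases rule: transfer_cases[of \<mu> u' i j]) (auto intro!: transfer_ge dominates_improves_source[OF _ assms])

lemma transfer_relabel:
  assumes "bij \<tau>"
  shows "transfer \<mu> (\<lambda>a b. u (\<tau> a) (\<tau> b)) i j = transfer \<mu> u (\<tau> i) (\<tau> j)"
proof -
  have "{\<mu> (\<sigma> i) (\<sigma> j) |\<sigma>. dominates (\<lambda>a b. u (\<tau> a) (\<tau> b)) i j \<sigma>} =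
    {\<mu> (\<sigma> (\<tau> i)) (\<sigma> (\<tau> j)) |\<sigma>. dominates u (\<tau> i) (\<tau> j) \<sigma>}" (is "?A = ?B")
  proof
    show "?B \<subseteq> ?A"
    proof safe
      fix \<sigma> assume "dominates u (\<tau> i) (\<tau> j) \<sigma>"
      then show "\<exists>\<sigma>'. \<mu> (\<sigma> (\<tau> i)) (\<sigma> (\<tau> j)) = \<mu> (\<sigma>' i) (\<sigma>' j) \<and> dominates (\<lambda>a b. u (\<tau> a) (\<tau> b)) i j \<sigma>'"
        using dominates_relabel[OF assms, of u i j \<sigma>] by (intro exI[of _ "\<sigma> \<circ> \<tau>"]) simp
    qed
    show "?A \<subseteq> ?B"
    proof safe
      fix \<sigma> assume "dominates (\<lambda>a b. u (\<tau> a) (\<tau> b)) i j \<sigma>"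
      moreover have "\<sigma> = (\<sigma> \<circ> inv \<tau>) \<circ> \<tau>" using assms by (auto simp: fun_eq_iff bij_def)
      ultimately show "\<exists>\<sigma>'. \<mu> (\<sigma> i) (\<sigma> j) = \<mu> (\<sigma>' (\<tau> i)) (\<sigma>' (\<tau> j)) \<and> dominates u (\<tau> i) (\<tau> j) \<sigma>'"
        using dominates_relabel[OF assms, of u i j "\<sigma> \<circ> inv \<tau>"] by (intro exI[of _ "\<sigma> \<circ> inv \<tau>"]) (metis comp_apply)
    qed
  qed
  then show ?thesis using assms by (simp add: transfer_def bij_def inj_eq)
qed

section \<open>The bound on outgoing mass, with \<open>\<mu> r s\<close> as the number of arcs from
  \<open>r\<close> to \<open>s\<close>\<close>

context
  fixes \<mu> :: "'n::{finite,linorder} \<Rightarrow> 'n \<Rightarrow> nat"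
  assumes sum_mult: "\<And>r. (\<Sum>s\<in>UNIV. \<mu> r s) = 2"
    and mult_le: "\<And>r s. \<mu> r s > 0 \<Longrightarrow> s \<le> r"
    and mult_2: "\<And>r s. \<mu> r s \<ge> 2 \<Longrightarrow> s = Min UNIV \<or> s = r"
begin

lemma sum_mult_le: "(\<Sum>s\<in>S. \<mu> r s) \<le> 2"
  unfolding sum_mult[of r, symmetric] by (rule sum_mono2) auto

lemma transfer_posE:
  assumes "transfer \<mu> u i j > 0"
  obtains \<sigma> where "i \<noteq> j" "dominates u i j \<sigma>" "transfer \<mu> u i j = \<mu> (\<sigma> i) (\<sigma> j)" "\<sigma> j < \<sigma> i"
proof (cases rule: transfer_cases[of \<mu> u i j])
  case (2 \<sigma>)
  then have "\<sigma> j \<le> \<sigma> i" "\<sigma> j \<noteq> \<sigma> i" using mult_le assms dominates_eq_iff[of u i j \<sigma>] by auto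
  then show ?thesis using that 2 by force
qed (use assms in auto)

lemma transfer_le_2: "transfer \<mu> u i j \<le> 2"
  using sum_mult_le[of _ "{_}"] by (cases rule: transfer_cases[of \<mu> u i j]) auto

text \<open>If some receiver gets two units, its label is vertex 1 and a second receiver would
  reveal a third arc out of the same vertex. Otherwise each receiver gets at most one unit, and
  three receivers would reveal three arcs.\<close>

lemma sum_transfer_le:
  assumes u: "skew u"
  shows "(\<Sum>j\<in>UNIV. transfer \<mu> u i j) \<le> 2"
proof -
  let ?t = "transfer \<mu> u i"
  let ?S = "{j. ?t j > 0}"
  have sum: "(\<Sum>j\<in>UNIV. ?t j) = (\<Sum>j\<in>?S. ?t j)" by (rule sum.mono_neutral_right) auto
  show ?thesis
  proof (cases "\<exists>j. ?t j \<ge> 2")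
    case True
    then obtain j where j: "?t j \<ge> 2" by blast
    then obtain A where A: "i \<noteq> j" "dominates u i j A" "?t j = \<mu> (A i) (A j)" "A j < A i"
      using transfer_posE[of u i j] by auto
    have Min: "A j = Min UNIV" using mult_2[of "A i" "A j"] A j by auto
    have "?S \<subseteq> {j}"
    proof (rule ccontr)
      assume "\<not> ?thesis"
      then obtain k where k: "?t k > 0" "k \<noteq> j" by blast
      then obtain B where B: "i \<noteq> k" "dominates u i k B" "?t k = \<mu> (B i) (B k)" "B k < B i"
        using transfer_posE[of u i k] by auto
      have eq: "B i = A i \<and> B k = A k"
        using A B k by (intro dominates_Min_agree[OF _ u A(2) B(2) Min B(4)]) auto
      have "A j \<noteq> A k" using dominates_eq_iff[OF A(2)] k by auto
      then have "(\<Sum>s\<in>{A j, A k}. \<mu> (A i) s) \<ge> 3" using A(3) B(3) eq j k by simp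
      then show False using sum_mult_le[of "A i" "{A j, A k}"] by simp
    qed
    then have "(\<Sum>j\<in>UNIV. ?t j) \<le> (\<Sum>j\<in>{j}. ?t j)" unfolding sum by (intro sum_mono2) auto
    then show ?thesis using transfer_le_2[of u i j] by simp
  next
    case False
    have "card ?S < 3"
    proof (rule ccontr)
      assume "\<not> ?thesis"
      then obtain T where T: "T \<subseteq> ?S" "card T = 3" using obtain_subset_with_card_n[of 3 ?S] by auto
      then obtain a b c where abc: "T = {a, b, c}" "distinct [a, b, c]" by (auto simp: card_3_iff)
      then have pos: "?t a > 0" "?t b > 0" "?t c > 0" using T by auto
      obtain A where A: "i \<noteq> a" "dominates u i a A" "?t a = \<mu> (A i) (A a)" "A a < A i"
        using transfer_posE[OF pos(1)] by blast
      obtain B where B: "i \<noteq> b" "dominates u i b B" "?t b = \<mu> (B i) (B b)" "B b < B i"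
        using transfer_posE[OF pos(2)] by blast
      obtain C where C: "i \<noteq> c" "dominates u i c C" "?t c = \<mu> (C i) (C c)" "C c < C i"
        using transfer_posE[OF pos(3)] by blast
      have 1: "A i = B i \<and> B a = A a \<and> A a \<noteq> B b"
        using A B C abc by (intro dominates_three_agree[OF _ u A(2) B(2) C(2)]) auto
      have 2: "A i = C i \<and> C a = A a \<and> A a \<noteq> C c"
        using A B C abc by (intro dominates_three_agree[OF _ u A(2) C(2) B(2)]) auto
      have 3: "B i = C i \<and> C b = B b \<and> B b \<noteq> C c"
        using A B C abc by (intro dominates_three_agree[OF _ u B(2) C(2) A(2)]) auto
      have "(\<Sum>s\<in>{A a, B b, C c}. \<mu> (A i) s) \<ge> 3" using A(3) B(3) C(3) pos 1 2 3 by simp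
      then show False using sum_mult_le[of "A i" "{A a, B b, C c}"] by simp
    qed
    moreover have "(\<Sum>j\<in>?S. ?t j) \<le> (\<Sum>j\<in>?S. 1)"
    proof (rule sum_mono)
      fix j show "?t j \<le> 1" using False by (metis One_nat_def Suc_1 not_less_eq_eq)
    qed
    ultimately show ?thesis unfolding sum by simp
  qed
qed

text \<open>The identity labeling gives the lower bound; by \<open>dominates_wt\<close> every
  labeling with a positive contribution reads off the same arc.\<close>

lemma transfer_wt: "transfer \<mu> wt i j = (if i = j then 0 else \<mu> i j)"
proof (cases "i = j")
  case False
  have "\<mu> i j \<le> transfer \<mu> wt i j" using transfer_ge[OF False dominates_id, of \<mu>] by simp
  moreover have "transfer \<mu> wt i j \<le> \<mu> i j"
  proof (cases "transfer \<mu> wt i j > 0")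
    case True
    then obtain \<sigma> where "dominates wt i j \<sigma>" "transfer \<mu> wt i j = \<mu> (\<sigma> i) (\<sigma> j)" "\<sigma> j < \<sigma> i"
      by (rule transfer_posE)
    then show ?thesis using dominates_wt[of i j \<sigma>] by simp
  qed simp
  ultimately show ?thesis using False by simp
qed (simp add: transfer_def)

end

subsection \<open>Round robin tournaments\<close>

lemma win_matrices_bounds: "P \<in> win_matrices \<Longrightarrow> 0 \<le> P $ i $ j \<and> P $ i $ j \<le> 1"
  by (simp add: win_matrices_def)

lemma win_matrices_swap: "P \<in> win_matrices \<Longrightarrow> P $ j $ i = 1 - P $ i $ j"
  by (auto simp: win_matrices_def vec_eq_iff transpose_def algebra_simps)

section \<open>Win probabilities and honesty of composed rules\<close>

lemma win_prob_Play:
  assumes "P \<in> win_matrices"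
  shows "win_prob (Play i j A B) P k = P $ i $ j * win_prob A P k + (1 - P $ i $ j) * win_prob B P k"
  using win_matrices_bounds[OF assms, of i j] unfolding win_prob_def by (simp add: pmf_bind)

lemma winner_pmf_Choose_map: "winner_pmf P (Choose (map_pmf f D)) = bind_pmf D (\<lambda>x. winner_pmf P (f x))"
  by (simp add: bind_eq_join_pmf map_pmf_comp)

lemma win_prob_Choose_Announce: "win_prob (Choose (map_pmf Announce_Winner D)) P k = pmf D k"
  unfolding win_prob_def winner_pmf_Choose_map by (simp add: bind_return_pmf')

lemma win_prob_Choose_uniform:
  assumes "finite A" "A \<noteq> {}"
  shows "win_prob (Choose (map_pmf f (pmf_of_set A))) P k = (\<Sum>x\<in>A. win_prob (f x) P k) / card A"
  unfolding win_prob_def winner_pmf_Choose_map by (rule pmf_bind_pmf_of_set) (use assms in auto)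

lemma win_prob_Choose_bernoulli:
  assumes "0 \<le> p" "p \<le> 1"
  shows "win_prob (Choose (map_pmf (\<lambda>b. if b then S else T) (bernoulli_pmf p))) P k =
    p * win_prob S P k + (1 - p) * win_prob T P k"
  using assms unfolding win_prob_def winner_pmf_Choose_map by (simp add: pmf_bind)

lemma honest_Announce_Winner: "honest (Announce_Winner k)"
proof -
  have "T = Announce_Winner k" if "state (Announce_Winner k) T" for T
    using that by (induction rule: state.induct) auto
  then show ?thesis unfolding honest_def by blast
qed

lemma honest_Choose:
  assumes "\<And>A. A \<in> set_pmf D \<Longrightarrow> honest A"
  shows "honest (Choose D)"
proof -
  have "T = Choose D \<or> (\<exists>A\<in>set_pmf D. state A T)" if "state (Choose D) T" for T
    using that by (induction rule: state.induct) (auto intro: state.intros)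
  then show ?thesis using assms unfolding honest_def by blast
qed

lemma honest_Play:
  assumes "honest A" "honest B"
    and "\<And>P. P \<in> win_matrices \<Longrightarrow> win_prob B P i \<le> win_prob A P i \<and> win_prob A P j \<le> win_prob B P j"
  shows "honest (Play i j A B)"
proof -
  have "T = Play i j A B \<or> state A T \<or> state B T" if "state (Play i j A B) T" for T
    using that by (induction rule: state.induct) (auto intro: state.intros)
  then show ?thesis using assms unfolding honest_def by blast
qed

lemma plays_at_most_mono: "plays_at_most N T \<Longrightarrow> N \<le> M \<Longrightarrow> plays_at_most M T"
proof (induction arbitrary: M rule: plays_at_most.induct)
  case (2 i j N A B)
  then show ?case by (cases M) (auto intro: plays_at_most.intros)
qed (auto intro: plays_at_most.intros)

section \<open>Fixed schedules followed by a rule that depends on the score differences\<close>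

definition count_win :: "'n \<Rightarrow> 'n \<Rightarrow> ('n \<Rightarrow> 'n \<Rightarrow> int) \<Rightarrow> 'n \<Rightarrow> 'n \<Rightarrow> int" where
  "count_win a b d = (\<lambda>x y. d x y + of_bool (x = a \<and> y = b) - of_bool (x = b \<and> y = a))"

primrec play_all :: "(('n \<Rightarrow> 'n \<Rightarrow> int) \<Rightarrow> 'n pmf) \<Rightarrow> ('n \<times> 'n) list \<Rightarrow> ('n \<Rightarrow> 'n \<Rightarrow> int) \<Rightarrow> 'n rules" where
  "play_all E [] d = Choose (map_pmf Announce_Winner (E d))"
| "play_all E (m # ms) d = Play (fst m) (snd m)
     (play_all E ms (count_win (fst m) (snd m) d)) (play_all E ms (count_win (snd m) (fst m) d))"

lemma skew_count_win:
  assumes "skew d" shows "skew (count_win a b d)"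
  unfolding skew_def
proof (intro allI)
  fix x y
  have "d y x = - d x y" using assms unfolding skew_def by blast
  then show "count_win a b d y x = - count_win a b d x y" by (simp add: count_win_def conj_commute)
qed

lemma improves_count_win: "improves k d d' \<Longrightarrow> improves k (count_win a b d) (count_win a b d')"
  by (auto simp: improves_def skew_count_win) (auto simp: count_win_def)

lemma improves_count_win_winner:
  assumes "skew d" "a \<noteq> b" shows "improves a (count_win b a d) (count_win a b d)"
  using assms by (auto simp: improves_def skew_count_win) (auto simp: count_win_def)

lemma plays_at_most_play_all:
  "(\<And>m. m \<in> set ms \<Longrightarrow> fst m \<noteq> snd m) \<Longrightarrow> plays_at_most (length ms) (play_all E ms d)"
  by (induction ms arbitrary: d) (auto intro!: plays_at_most.intros)

definition monotone_rule :: "(('n \<Rightarrow> 'n \<Rightarrow> int) \<Rightarrow> 'n pmf) \<Rightarrow> bool" where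
  "monotone_rule E \<longleftrightarrow> (\<forall>k d d'. improves k d d' \<longrightarrow> pmf (E d) k \<le> pmf (E d') k)"

definition equivariant_rule :: "(('n \<Rightarrow> 'n \<Rightarrow> int) \<Rightarrow> 'n pmf) \<Rightarrow> bool" where
  "equivariant_rule E \<longleftrightarrow>
     (\<forall>d \<tau> k. skew d \<longrightarrow> bij \<tau> \<longrightarrow> pmf (E (\<lambda>a b. d (\<tau> a) (\<tau> b))) k = pmf (E d) (\<tau> k))"

text \<open>Coupling: \<open>improves k\<close> survives a further match with the same result in
  both runs, so it lasts until the end, where \<open>monotone_rule\<close> applies.\<close>

lemma win_prob_play_all_mono:
  assumes "P \<in> win_matrices" "monotone_rule E" "improves k d d'"
  shows "win_prob (play_all E ms d) P k \<le> win_prob (play_all E ms d') P k"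
  using assms(3)
proof (induction ms arbitrary: d d')
  case Nil
  then show ?case using assms(2) by (auto simp: win_prob_Choose_Announce monotone_rule_def simp del: winner_pmf.simps)
next
  case (Cons m ms)
  show ?case unfolding play_all.simps win_prob_Play[OF assms(1)]
    using win_matrices_bounds[OF assms(1)]
    by (intro add_mono mult_left_mono Cons.IH improves_count_win Cons.prems) auto
qed

lemma honest_play_all:
  fixes E :: "('n::finite \<Rightarrow> 'n \<Rightarrow> int) \<Rightarrow> 'n pmf"
  assumes "monotone_rule E" "\<And>m. m \<in> set ms \<Longrightarrow> fst m \<noteq> snd m" "skew d"
  shows "honest (play_all E ms d)"
  using assms(2,3)
proof (induction ms arbitrary: d)
  case Nil
  then show ?case by (auto intro!: honest_Choose honest_Announce_Winner)
next
  case (Cons m ms)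
  have "fst m \<noteq> snd m" using Cons.prems by simp
  then show ?case unfolding play_all.simps
    by (intro honest_Play Cons.IH skew_count_win conjI win_prob_play_all_mono assms(1)
        improves_count_win_winner) (use Cons.prems \<open>fst m \<noteq> snd m\<close> in \<open>simp_all add: eq_commute\<close>)
qed

text \<open>Renaming the players renames the schedule as well. This change of schedule is what the
  random relabeling in \<open>shuffled\<close> averages out.\<close>

lemma win_prob_play_all_relabel:
  assumes P: "P \<in> win_matrices" and Q: "Q \<in> win_matrices" and \<tau>: "bij \<tau>" and PQ: "\<And>i j. Q $ \<tau> i $ \<tau> j = P $ i $ j"
    and E: "equivariant_rule E" and "skew d"
  shows "win_prob (play_all E ms (\<lambda>a b. d (\<tau> a) (\<tau> b))) P k =
    win_prob (play_all E (map (map_prod \<tau> \<tau>) ms) d) Q (\<tau> k)"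
  using assms(6)
proof (induction ms arbitrary: d)
  case Nil
  then show ?case using \<tau> E by (auto simp: win_prob_Choose_Announce equivariant_rule_def simp del: winner_pmf.simps)
next
  case (Cons m ms)
  have *: "count_win a b (\<lambda>a b. d (\<tau> a) (\<tau> b)) = (\<lambda>x y. count_win (\<tau> a) (\<tau> b) d (\<tau> x) (\<tau> y))" for a b
    using \<tau> by (auto simp: count_win_def fun_eq_iff bij_def inj_eq)
  show ?case
    by (simp add: win_prob_Play[OF P] win_prob_Play[OF Q] PQ * Cons.IH skew_count_win Cons.prems)
qed

text \<open>
  The schedule announces the pairs in a fixed order and is not symmetric, hence the random relabeling.
\<close>

definition shuffled :: "(('n::finite \<Rightarrow> 'n \<Rightarrow> int) \<Rightarrow> 'n pmf) \<Rightarrow> ('n \<times> 'n) list \<Rightarrow> 'n rules" where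
  "shuffled E ms = Choose (map_pmf (\<lambda>\<tau>. play_all E (map (map_prod \<tau> \<tau>) ms) (\<lambda>_ _. 0)) (pmf_of_set {\<tau>. bij \<tau>}))"

lemma bij_set: "finite {\<tau> :: 'n::finite \<Rightarrow> 'n. bij \<tau>}" "{\<tau> :: 'n \<Rightarrow> 'n. bij \<tau>} \<noteq> {}"
  using bij_id by auto

lemma skew_zero: "skew (\<lambda>_ _. 0)"
  by (simp add: skew_def)

lemma win_prob_shuffled:
  fixes k :: "'n::finite"
  shows "win_prob (shuffled E ms) P k =
     (\<Sum>\<tau> | bij \<tau>. win_prob (play_all E (map (map_prod \<tau> \<tau>) ms) (\<lambda>_ _. 0)) P k) / card {\<tau> :: 'n \<Rightarrow> 'n. bij \<tau>}"
  unfolding shuffled_def by (rule win_prob_Choose_uniform[OF bij_set])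

lemma shuffled_fair:
  fixes E :: "('n::finite \<Rightarrow> 'n \<Rightarrow> int) \<Rightarrow> 'n pmf"
  assumes "monotone_rule E" "equivariant_rule E" "\<And>m. m \<in> set ms \<Longrightarrow> fst m \<noteq> snd m"
  shows "tournament (shuffled E ms)" "honest (shuffled E ms)" "symmetric_tournament (shuffled E ms)"
proof -
  have ne: "fst m \<noteq> snd m" if "m \<in> set (map (map_prod \<tau> \<tau>) ms)" "bij \<tau>" for m and \<tau> :: "'n \<Rightarrow> 'n"
    using that assms(3) by (auto simp: bij_def inj_eq)
  have "plays_at_most (length ms) (shuffled E ms)"
    unfolding shuffled_def
  proof (rule plays_at_most.intros)
    fix A assume "A \<in> set_pmf (map_pmf (\<lambda>\<tau>. play_all E (map (map_prod \<tau> \<tau>) ms) (\<lambda>_ _. 0)) (pmf_of_set {\<tau>. bij \<tau>}))"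
    then obtain \<tau> where "bij \<tau>" and A: "A = play_all E (map (map_prod \<tau> \<tau>) ms) (\<lambda>_ _. 0)"
      by (auto simp: set_pmf_of_set[OF bij_set(2,1)])
    show "plays_at_most (length ms) A"
      using plays_at_most_play_all[OF ne[OF _ \<open>bij \<tau>\<close>]] unfolding A by (metis length_map)
  qed
  then show "tournament (shuffled E ms)" unfolding tournament_def by blast
  show "honest (shuffled E ms)"
    unfolding shuffled_def
    by (rule honest_Choose) (auto simp: set_pmf_of_set[OF bij_set(2,1)] intro!: honest_play_all[OF assms(1) ne] skew_zero)
  show "symmetric_tournament (shuffled E ms)"
    unfolding symmetric_tournament_def
  proof safe
    fix P Q :: "real^'n^'n" and \<sigma> :: "'n \<Rightarrow> 'n" and i
    assume *: "P \<in> win_matrices" "Q \<in> win_matrices" "bij \<sigma>" "\<forall>i j. Q $ \<sigma> i $ \<sigma> j = P $ i $ j"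
    let ?w = "\<lambda>\<tau>. win_prob (play_all E (map (map_prod \<tau> \<tau>) ms) (\<lambda>_ _. 0))"
    have "?w \<tau> P i = ?w (\<sigma> \<circ> \<tau>) Q (\<sigma> i)" for \<tau>
      using win_prob_play_all_relabel[OF *(1-3) _ assms(2) skew_zero, of "map (map_prod \<tau> \<tau>) ms" i] *(4)
      by (simp add: map_prod.comp)
    then have "(\<Sum>\<tau> | bij \<tau>. ?w \<tau> P i) = (\<Sum>\<tau> | bij \<tau>. ?w (\<sigma> \<circ> \<tau>) Q (\<sigma> i))" by simp
    \<comment> \<open>Composition with \<open>\<sigma>\<close> permutes the bijections.\<close>
    also have "\<dots> = (\<Sum>\<tau> | bij \<tau>. ?w \<tau> Q (\<sigma> i))"
      using *(3) by (intro sum.reindex_bij_witness[of _ "\<lambda>\<tau>. inv \<sigma> \<circ> \<tau>" "\<lambda>\<tau>. \<sigma> \<circ> \<tau>"])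
        (auto simp: fun_eq_iff bij_is_inj bij_is_surj surj_f_inv_f bij_imp_bij_inv intro: bij_comp)
    finally show "win_prob (shuffled E ms) P i = win_prob (shuffled E ms) Q (\<sigma> i)"
      unfolding win_prob_shuffled by simp
  qed
qed

definition num_matches :: "('n \<times> 'n) list \<Rightarrow> 'n \<Rightarrow> 'n \<Rightarrow> nat" where
  "num_matches ms a b = length (filter (\<lambda>m. m = (a, b) \<or> m = (b, a)) ms)"

text \<open>
  Chebyshev's inequality in disguise: the right-hand side is \<open>C\<close> times the sum of the second moments of
  the final score differences around \<open>c\<close>, which the induction on the schedule computes exactly.
\<close>

lemma win_prob_play_all_approx:
  fixes E :: "('n::finite \<Rightarrow> 'n \<Rightarrow> int) \<Rightarrow> 'n pmf"
  assumes P: "P \<in> win_matrices" and S: "\<And>m. m \<in> S \<Longrightarrow> fst m \<noteq> snd m" and ne: "\<And>m. m \<in> set ms \<Longrightarrow> fst m \<noteq> snd m"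
    and E: "\<And>d. skew d \<Longrightarrow> \<bar>pmf (E d) k - v\<bar> \<le> C * (\<Sum>(a, b)\<in>S. (d a b - c a b)\<^sup>2)"
    and d: "skew d"
  shows "\<bar>win_prob (play_all E ms d) P k - v\<bar> \<le>
    C * (\<Sum>(a, b)\<in>S. (d a b + num_matches ms a b * (2 * P $ a $ b - 1) - c a b)\<^sup>2 +
       num_matches ms a b * (1 - (2 * P $ a $ b - 1)\<^sup>2))"
  using ne d
proof (induction ms arbitrary: d)
  case Nil
  then show ?case using E by (simp add: win_prob_Choose_Announce num_matches_def del: winner_pmf.simps)
next
  case (Cons m ms)
  obtain x y where m: "m = (x, y)" by (cases m)
  define p where "p = P $ x $ y"
  \<comment> \<open>Squared bias plus variance: one match between \<open>a\<close> and
    \<open>b\<close> changes the difference by 1 or -1, with mean \<open>2 * P $ a $ b - 1\<close>.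
    Averaging \<open>q\<close> over the result of the first match gives \<open>q\<close> for the
    longer schedule.\<close>
  define q where "q = (\<lambda>ms (d::'n\<Rightarrow>'n\<Rightarrow>int) (a, b). (d a b + num_matches ms a b * (2 * P $ a $ b - 1) - c a b)\<^sup>2 +
       num_matches ms a b * (1 - (2 * P $ a $ b - 1)\<^sup>2))"
  have p: "0 \<le> p" "p \<le> 1" using win_matrices_bounds[OF P] by (auto simp: p_def)
  have xy: "x \<noteq> y" using Cons.prems m by force
  let ?W1 = "win_prob (play_all E ms (count_win x y d)) P k"
  let ?W2 = "win_prob (play_all E ms (count_win y x d)) P k"
  have IH: "\<bar>win_prob (play_all E ms (count_win a b d)) P k - v\<bar> \<le> C * sum (q ms (count_win a b d)) S" for a b
    unfolding q_def by (rule Cons.IH) (use Cons.prems skew_count_win in simp_all)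
  have W: "win_prob (play_all E (m # ms) d) P k - v = p * (?W1 - v) + (1 - p) * (?W2 - v)"
    by (simp add: m win_prob_Play[OF P] p_def algebra_simps)
  have "\<bar>win_prob (play_all E (m # ms) d) P k - v\<bar> \<le> p * \<bar>?W1 - v\<bar> + (1 - p) * \<bar>?W2 - v\<bar>"
    unfolding W using abs_triangle_ineq[of "p * (?W1 - v)" "(1 - p) * (?W2 - v)"] p by (simp add: abs_mult)
  also have "\<dots> \<le> p * (C * sum (q ms (count_win x y d)) S) + (1 - p) * (C * sum (q ms (count_win y x d)) S)"
    using p IH by (intro add_mono mult_left_mono) simp_all
  also have "\<dots> = C * (\<Sum>m\<in>S. p * q ms (count_win x y d) m + (1 - p) * q ms (count_win y x d) m)"
    unfolding sum.distrib sum_distrib_left[symmetric] by (simp add: algebra_simps)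
  also have "\<dots> = C * sum (q (m # ms) d) S"
  proof (intro arg_cong[where f = "\<lambda>x. C * x"] sum.cong refl, clarify)
    fix a b assume "(a, b) \<in> S"
    then have ab: "a \<noteq> b" using S by force
    consider "x = a" "y = b" | "x = b" "y = a" | "(x, y) \<noteq> (a, b)" "(x, y) \<noteq> (b, a)" by blast
    then show "p * q ms (count_win x y d) (a, b) + (1 - p) * q ms (count_win y x d) (a, b) = q (m # ms) d (a, b)"
    proof cases
      case 1
      then show ?thesis using ab
        by (simp add: q_def m num_matches_def count_win_def p_def) (simp add: algebra_simps power2_eq_square)
    next
      case 2
      then show ?thesis using ab win_matrices_swap[OF P, of b a]
        by (simp add: q_def m num_matches_def count_win_def p_def) (simp add: algebra_simps power2_eq_square)
    next
      case 3
      then have "count_win x y d a b = d a b" "count_win y x d a b = d a b"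
        "num_matches (m # ms) a b = num_matches ms a b"
        by (auto simp: count_win_def num_matches_def m)
      then show ?thesis by (simp add: q_def distrib_right[symmetric] del: distrib_right_numeral)
    qed
  qed
  finally show ?case unfolding q_def .
qed

subsection \<open>Realizing digraph vectors\<close>

text \<open>Uniform mass \<open>2 / (2 * n)\<close>, plus what is received, minus what is given
  away. That this is a distribution for skew \<open>u\<close> is shown in
  \<open>pmf_transfer_rule\<close>.\<close>

definition transfer_rule :: "('n::{finite,linorder} \<Rightarrow> 'n \<Rightarrow> nat) \<Rightarrow> ('n \<Rightarrow> 'n \<Rightarrow> int) \<Rightarrow> 'n pmf" where
  "transfer_rule \<mu> u = embed_pmf (\<lambda>k.
     (2 + (\<Sum>i\<in>UNIV. real (transfer \<mu> u i k)) - (\<Sum>j\<in>UNIV. real (transfer \<mu> u k j))) / (2 * real CARD('n)))"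

text \<open>
  Sum of floor and ceiling is an odd function, which keeps \<open>u\<close> skew; off the diagonal the weights are odd
  integers, and \<open>\<lfloor>x\<rfloor> + \<lceil>x\<rceil>\<close> is locally constant at \<open>x = w/2\<close>.
\<close>

definition round_diff :: "real \<Rightarrow> ('n \<Rightarrow> 'n \<Rightarrow> int) \<Rightarrow> 'n \<Rightarrow> 'n \<Rightarrow> int" where
  "round_diff t d = (\<lambda>a b. \<lfloor>d a b / (2 * t)\<rfloor> + \<lceil>d a b / (2 * t)\<rceil>)"

lemma skew_round_diff: "skew d \<Longrightarrow> skew (round_diff t d)"
  unfolding skew_def round_diff_def
proof (intro allI)
  fix a b assume "\<forall>a b. d b a = - d a b"
  then have "real_of_int (d b a) / (2 * t) = - (real_of_int (d a b) / (2 * t))" by (metis minus_divide_left of_int_minus)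
  then show "\<lfloor>d b a / (2 * t)\<rfloor> + \<lceil>d b a / (2 * t)\<rceil> = - (\<lfloor>d a b / (2 * t)\<rfloor> + \<lceil>d a b / (2 * t)\<rceil>)"
    by (simp add: floor_minus ceiling_minus)
qed

lemma improves_round_diff: "t > 0 \<Longrightarrow> improves k d d' \<Longrightarrow> improves k (round_diff t d) (round_diff t d')"
  unfolding improves_def
  by (auto simp: skew_round_diff) (auto simp: round_diff_def intro!: add_mono floor_mono ceiling_mono divide_right_mono)

lemma odd_wt: "a \<noteq> b \<Longrightarrow> odd (wt a b)"
  by (auto simp: wt_def weight_def)

text \<open>Off the diagonal \<open>wt a b = 2 * m + 1\<close>, and a deviation below
  \<open>t\<close> keeps \<open>d a b / (2 * t)\<close> strictly between \<open>m\<close> and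
  \<open>m + 1\<close>.\<close>

lemma round_diff_eq_wt:
  fixes t :: real
  assumes d: "skew d" and t: "t > 0" and near: "\<And>a b. a \<noteq> b \<Longrightarrow> \<bar>d a b - t * wt a b\<bar> < t"
  shows "round_diff t d = wt"
proof (intro ext)
  fix a b
  show "round_diff t d a b = wt a b"
  proof (cases "a = b")
    case True
    have "d a a = - d a a" "wt a a = - wt a a" using d wt_swap unfolding skew_def by blast+
    then show ?thesis using True by (simp add: round_diff_def)
  next
    case False
    then obtain m where m: "wt a b = 2 * m + 1" using odd_wt by (metis oddE)
    have "\<bar>d a b - t * (2 * m + 1)\<bar> < t" using near[OF False] m by simp
    then have "m * (2 * t) < d a b" "d a b < (m + 1) * (2 * t)"
      by (auto simp: abs_less_iff algebra_simps)
    then have x: "m < d a b / (2 * t)" "d a b / (2 * t) < m + 1"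
      using t by (auto simp: pos_less_divide_eq pos_divide_less_eq)
    then have "\<lfloor>d a b / (2 * t)\<rfloor> = m" "\<lceil>d a b / (2 * t)\<rceil> = m + 1" by (auto simp: floor_eq_iff ceiling_eq_iff)
    then show ?thesis using m by (simp add: round_diff_def)
  qed
qed

lemma abs_wt_le: "\<bar>wt a b\<bar> \<le> 5 * (int CARD('n))\<^sup>2" for a b :: "'n::{finite,linorder}"
proof -
  have "\<bar>weight n x y\<bar> \<le> 5 * (int n)\<^sup>2" if "x < n" "y < n" for n x y
  proof -
    have n: "int n \<ge> 1" using that by simp
    then have le: "int n \<le> int n * int n" by simp
    have bounds: "0 \<le> int n * (int n - int z)" "int n * (int n - int z) \<le> int n * int n" if "z < n" for z
      using that by (auto intro!: mult_left_mono)
    have arith: "w \<le> 5 * Q \<and> - w \<le> 5 * Q"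
      if "w = 2 * (A + z) + 1 \<or> w = - (2 * (A + z) + 1)" "0 \<le> A" "A \<le> Q" "0 \<le> z" "z < l" "l \<le> Q"
      for w A Q z l :: int
      using that by auto
    show ?thesis
    proof (cases x y rule: linorder_cases)
      case less
      then have "weight n x y = 2 * (int n * (int n - int x) + int y) + 1" by (simp add: weight_def)
      then show ?thesis
        using arith[of "weight n x y" _ "int y", OF _ bounds[OF that(1)] _ _ le] that
        unfolding power2_eq_square abs_le_iff by simp
    next
      case greater
      then have "weight n x y = - (2 * (int n * (int n - int y) + int x) + 1)" by (simp add: weight_def)
      then show ?thesis
        using arith[of "weight n x y" _ "int x", OF _ bounds[OF that(2)] _ _ le] that
        unfolding power2_eq_square abs_le_iff by simp
    qed simp
  qed
  then show ?thesis unfolding wt_def using position_less_card by blast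
qed

text \<open>The constant balances the bound in \<open>abs_wt_le\<close>: a perturbation of
  \<open>1 / 2\<close> by \<open>scale\<close> times a weight stays in the unit interval.\<close>

definition scale :: "'n::finite itself \<Rightarrow> real" where
  "scale _ = 1 / (10 * (real CARD('n))\<^sup>2)"

definition wt_matrix :: "((real, 'n) vec, 'n::{finite,linorder}) vec" where
  "wt_matrix = (\<chi> i j. 1 / 2 + scale TYPE('n) * wt i j)"

lemma scale_pos: "scale TYPE('n::finite) > 0"
  by (simp add: scale_def)

lemma wt_matrix_doubly_monotonic: "(wt_matrix :: ((real, 'n) vec, 'n::{finite,linorder}) vec) \<in> doubly_monotonic"
proof -
  have "\<bar>scale TYPE('n) * wt a b\<bar> \<le> 1 / 2" for a b :: 'n
  proof -
    have "\<bar>real_of_int (wt a b)\<bar> \<le> 5 * (real CARD('n))\<^sup>2"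
      using abs_wt_le[of a b] by (metis (mono_tags, lifting) of_int_abs of_int_le_iff of_int_mult of_int_numeral of_int_of_nat_eq of_int_power)
    then show ?thesis by (simp add: scale_def divide_simps abs_mult)
  qed
  then have "0 \<le> 1 / 2 + scale TYPE('n) * wt a b \<and> 1 / 2 + scale TYPE('n) * wt a b \<le> 1" for a b :: 'n
    by (smt (verit) field_sum_of_halves)
  moreover have "wt_matrix $ a $ b + wt_matrix $ b $ a = 1" for a b :: 'n
    using wt_swap[of a b] by (simp add: wt_matrix_def)
  ultimately have "(wt_matrix :: ((real, 'n) vec, 'n) vec) \<in> win_matrices"
    by (simp add: win_matrices_def vec_eq_iff transpose_def) (simp add: wt_matrix_def)
  then show ?thesis
    using scale_pos[where 'n = 'n]
    by (simp add: doubly_monotonic_def monotone_def wt_matrix_def wt_le_cancel wt_le_cancel2)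
qed

lemma wt_matrix_win: "wt_matrix \<in> win_matrices"
  using wt_matrix_doubly_monotonic unfolding doubly_monotonic_def by blast

section \<open>The transfer rule: fairness, value at the true weights, and approximation\<close>

context
  fixes \<mu> :: "'n::{finite,linorder} \<Rightarrow> 'n \<Rightarrow> nat"
  assumes sum_mult: "\<And>r. (\<Sum>s\<in>UNIV. \<mu> r s) = 2"
    and mult_le: "\<And>r s. \<mu> r s > 0 \<Longrightarrow> s \<le> r"
    and mult_2: "\<And>r s. \<mu> r s \<ge> 2 \<Longrightarrow> s = Min UNIV \<or> s = r"
begin

text \<open>Nonnegativity is the bound of two units on outgoing mass; the total is 1 because
  received and given mass cancel.\<close>

lemma pmf_transfer_rule:
  assumes "skew u"
  shows "pmf (transfer_rule \<mu> u) k =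
    (2 + (\<Sum>i\<in>UNIV. real (transfer \<mu> u i k)) - (\<Sum>j\<in>UNIV. real (transfer \<mu> u k j))) / (2 * real CARD('n))"
proof -
  let ?f = "\<lambda>k. (2 + (\<Sum>i\<in>UNIV. real (transfer \<mu> u i k)) - (\<Sum>j\<in>UNIV. real (transfer \<mu> u k j))) / (2 * real CARD('n))"
  have nonneg: "?f k \<ge> 0" for k
  proof -
    have "(\<Sum>j\<in>UNIV. real (transfer \<mu> u k j)) \<le> 2"
      using of_nat_mono[OF sum_transfer_le[OF sum_mult mult_le mult_2 assms, where i = k], where 'a = real] by simp
    moreover have "(\<Sum>i\<in>UNIV. real (transfer \<mu> u i k)) \<ge> 0" by (simp add: sum_nonneg)
    ultimately show ?thesis by simp
  qed
  have "(\<Sum>k\<in>UNIV. ?f k) = 1"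
    unfolding sum_divide_distrib[symmetric] sum_subtractf sum.distrib
    by (subst sum.swap) simp
  then have "(\<integral>\<^sup>+k. ennreal (?f k) \<partial>count_space UNIV) = 1"
    using nonneg by (simp add: nn_integral_count_space_finite sum_ennreal del: sum_divide_distrib)
  then show ?thesis unfolding transfer_rule_def by (rule pmf_embed_pmf[OF nonneg])
qed

lemma monotone_transfer_rule: "t > 0 \<Longrightarrow> monotone_rule (\<lambda>d. transfer_rule \<mu> (round_diff t d))"
  unfolding monotone_rule_def
proof safe
  fix k :: 'n and d d' :: "'n \<Rightarrow> 'n \<Rightarrow> int"
  assume "t > 0" "improves k d d'"
  then have i: "improves k (round_diff t d) (round_diff t d')" by (rule improves_round_diff)
  then have "skew (round_diff t d)" "skew (round_diff t d')" by (auto simp: improves_def)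
  then show "pmf (transfer_rule \<mu> (round_diff t d)) k \<le> pmf (transfer_rule \<mu> (round_diff t d')) k"
    using transfer_improves_target[OF i] transfer_improves_source[OF i]
    by (auto simp: pmf_transfer_rule intro!: divide_right_mono diff_mono add_mono sum_mono)
qed

lemma equivariant_transfer_rule: "equivariant_rule (\<lambda>d. transfer_rule \<mu> (round_diff t d))"
  unfolding equivariant_rule_def
proof safe
  fix d :: "'n \<Rightarrow> 'n \<Rightarrow> int" and \<tau> :: "'n \<Rightarrow> 'n" and k assume d: "skew d" and \<tau>: "bij \<tau>"
  let ?u = "round_diff t d"
  have u: "skew ?u" using d by (rule skew_round_diff)
  have eq: "round_diff t (\<lambda>a b. d (\<tau> a) (\<tau> b)) = (\<lambda>a b. ?u (\<tau> a) (\<tau> b))" by (simp add: round_diff_def)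
  have u': "skew (\<lambda>a b. ?u (\<tau> a) (\<tau> b))" using u unfolding skew_def by blast
  have re: "(\<Sum>i\<in>UNIV. h (\<tau> i)) = (\<Sum>i\<in>UNIV. h i)" for h :: "'n \<Rightarrow> real"
    using \<tau> by (rule sum.reindex_bij_betw)
  show "pmf (transfer_rule \<mu> (round_diff t (\<lambda>a b. d (\<tau> a) (\<tau> b)))) k = pmf (transfer_rule \<mu> ?u) (\<tau> k)"
    unfolding eq pmf_transfer_rule[OF u] pmf_transfer_rule[OF u'] transfer_relabel[OF \<tau>]
      re[of "\<lambda>i. real (transfer \<mu> ?u i (\<tau> k))"] re[of "\<lambda>j. real (transfer \<mu> ?u (\<tau> k) j)"] ..
qed

lemma skew_wt: "skew wt"
  unfolding skew_def using wt_swap by blast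

text \<open>Loops are left out of both sums and cancel; what is given away apart from them is
  \<open>2 - \<mu> k k\<close>, which leaves the indegree.\<close>

lemma pmf_transfer_rule_wt: "pmf (transfer_rule \<mu> wt) k = (\<Sum>i\<in>UNIV. real (\<mu> i k)) / (2 * real CARD('n))"
proof -
  have "(\<Sum>i\<in>UNIV. real (transfer \<mu> wt i k)) = (\<Sum>i\<in>UNIV. real (\<mu> i k)) - \<mu> k k"
    by (simp add: transfer_wt[OF sum_mult mult_le mult_2] sum.remove[of UNIV k] if_distrib cong: if_cong)
  moreover have "(\<Sum>j\<in>UNIV. real (transfer \<mu> wt k j)) = (\<Sum>j\<in>UNIV. real (\<mu> k j)) - \<mu> k k"
    by (simp add: transfer_wt[OF sum_mult mult_le mult_2] sum.remove[of UNIV k] if_distrib cong: if_cong)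
  moreover have "(\<Sum>j\<in>UNIV. real (\<mu> k j)) = 2" using sum_mult[of k] by (metis of_nat_numeral of_nat_sum)
  ultimately show ?thesis unfolding pmf_transfer_rule[OF skew_wt] by simp
qed

text \<open>The unit \<open>t\<close> is chosen so that the expected score difference after
  \<open>N\<close> matches is exactly \<open>t * wt a b\<close>. Only variance remains, at most
  \<open>N\<close> per pair, against \<open>t\<close> squared, which is of order \<open>N\<close>
  squared.\<close>

lemma win_prob_transfer_rule:
  fixes N :: nat
  assumes N: "N > 0" and ms: "\<And>m. m \<in> set ms \<Longrightarrow> fst m \<noteq> snd m"
    and num: "\<And>a b. a \<noteq> b \<Longrightarrow> num_matches ms a b = N"
  defines "t \<equiv> 2 * scale TYPE('n) * N"
  shows "\<bar>win_prob (play_all (\<lambda>d. transfer_rule \<mu> (round_diff t d)) ms (\<lambda>_ _. 0)) wt_matrix k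
      - pmf (transfer_rule \<mu> wt) k\<bar> \<le> (real CARD('n))\<^sup>2 / (4 * (scale TYPE('n))\<^sup>2 * N)"
proof -
  define S where "S = {(a :: 'n, b). a \<noteq> b}"
  have fin: "finite S" by simp
  have t: "t > 0" using N scale_pos[where 'n = 'n] by (simp add: t_def)
  have approx: "\<bar>pmf (transfer_rule \<mu> (round_diff t d)) k - pmf (transfer_rule \<mu> wt) k\<bar> \<le>
      1 / t\<^sup>2 * (\<Sum>(a, b)\<in>S. (d a b - t * wt a b)\<^sup>2)" if d: "skew d" for d
  \<comment> \<open>Either all deviations are below \<open>t\<close> and rounding recovers
    \<open>wt\<close> without error, or one squared deviation already makes the right-hand side at
    least 1.\<close>
  proof (cases "\<forall>a b. a \<noteq> b \<longrightarrow> \<bar>d a b - t * wt a b\<bar> < t")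
    case True
    then have "round_diff t d = wt" using round_diff_eq_wt[OF d t] by blast
    then show ?thesis by (auto intro!: divide_nonneg_nonneg sum_nonneg)
  next
    case False
    then obtain a b where ab: "a \<noteq> b" "\<bar>d a b - t * wt a b\<bar> \<ge> t" by force
    have "\<bar>pmf (transfer_rule \<mu> (round_diff t d)) k - pmf (transfer_rule \<mu> wt) k\<bar> \<le> 1"
      using pmf_nonneg pmf_le_1 by (smt (verit))
    also have "t\<^sup>2 \<le> (d a b - t * wt a b)\<^sup>2" using power_mono[OF ab(2), of 2] t by simp
    then have "t\<^sup>2 \<le> (\<Sum>(a, b)\<in>S. (d a b - t * wt a b)\<^sup>2)"
      using member_le_sum[of "(a, b)" S "\<lambda>(a, b). (d a b - t * wt a b)\<^sup>2"] ab(1) fin by (auto simp: S_def)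
    then have "1 \<le> 1 / t\<^sup>2 * (\<Sum>(a, b)\<in>S. (d a b - t * wt a b)\<^sup>2)" using t by simp
    finally show ?thesis by simp
  qed
  have "\<bar>win_prob (play_all (\<lambda>d. transfer_rule \<mu> (round_diff t d)) ms (\<lambda>_ _. 0)) wt_matrix k
      - pmf (transfer_rule \<mu> wt) k\<bar> \<le> 1 / t\<^sup>2 * (\<Sum>(a, b)\<in>S.
       ((0::int) + num_matches ms a b * (2 * wt_matrix $ a $ b - 1) - t * wt a b)\<^sup>2 +
       num_matches ms a b * (1 - (2 * wt_matrix $ a $ b - 1)\<^sup>2))"
    by (rule win_prob_play_all_approx[OF wt_matrix_win _ ms approx skew_zero]) (auto simp: S_def)
  also have "\<dots> \<le> 1 / t\<^sup>2 * (\<Sum>(a, b)\<in>S. real N)"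
  proof (intro mult_left_mono sum_mono, clarify)
    fix a b assume "(a, b) \<in> S"
    then have "num_matches ms a b = N" using num by (auto simp: S_def)
    moreover have "N * (2 * wt_matrix $ a $ b - 1) = t * wt a b" by (simp add: wt_matrix_def t_def)
    moreover have "N * (1 - (2 * wt_matrix $ a $ b - 1)\<^sup>2) \<le> N * (1::real)" by (rule mult_left_mono) auto
    ultimately show "((0::int) + num_matches ms a b * (2 * wt_matrix $ a $ b - 1) - t * wt a b)\<^sup>2 +
       num_matches ms a b * (1 - (2 * wt_matrix $ a $ b - 1)\<^sup>2) \<le> real N" by simp
  qed simp
  also have "\<dots> = card S * N / t\<^sup>2" by (simp add: case_prod_beta)
  also have "\<dots> \<le> (CARD('n))\<^sup>2 * N / t\<^sup>2"
  proof -
    have "card S \<le> card (UNIV :: ('n \<times> 'n) set)" by (rule card_mono) auto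
    then have "real (card S) \<le> real ((CARD('n))\<^sup>2)" unfolding of_nat_le_iff by (simp add: card_cartesian_product[of UNIV UNIV, simplified] power2_eq_square)
    then show ?thesis using N by (intro divide_right_mono mult_right_mono) auto
  qed
  also have "\<dots> = (real CARD('n))\<^sup>2 / (4 * (scale TYPE('n))\<^sup>2 * N)"
    using N by (simp add: t_def power2_eq_square)
  finally show ?thesis .
qed

end

section \<open>Mixtures of fair tournaments and the schedule\<close>

definition fair :: "'n::finite rules \<Rightarrow> bool" where
  "fair T \<longleftrightarrow> tournament T \<and> symmetric_tournament T \<and> honest T"

lemma fair_mixture:
  assumes S: "fair S" and T: "fair T" and p: "0 \<le> p" "p \<le> 1"
  shows "fair (Choose (map_pmf (\<lambda>b. if b then S else T) (bernoulli_pmf p)))" (is "fair ?M")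
proof -
  have sub: "A = S \<or> A = T" if "A \<in> set_pmf (map_pmf (\<lambda>b. if b then S else T) (bernoulli_pmf p))" for A
    using that by auto
  obtain N1 N2 where "plays_at_most N1 S" "plays_at_most N2 T"
    using S T unfolding fair_def tournament_def by blast
  then have "plays_at_most (max N1 N2) S" "plays_at_most (max N1 N2) T"
    by (auto elim: plays_at_most_mono)
  then have "plays_at_most (max N1 N2) ?M" using sub by (auto intro!: plays_at_most.intros)
  moreover have "honest ?M" using S T sub by (intro honest_Choose) (auto simp: fair_def)
  moreover have "symmetric_tournament ?M"
    using S T unfolding fair_def symmetric_tournament_def win_prob_Choose_bernoulli[OF p] by metis
  ultimately show ?thesis unfolding fair_def tournament_def by blast
qed

text \<open>A biased coin tossed before the first match decides which of the two tournaments is run,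
  at the same \<open>P\<close>.\<close>

lemma convex_win_vectors: "convex {win_vector T P | T. fair T}"
proof (rule convexI)
  fix x y :: "real ^ 'a" and u v :: real
  assume "x \<in> {win_vector T P |T. fair T}" "y \<in> {win_vector T P |T. fair T}" and uv: "0 \<le> u" "0 \<le> v" "u + v = 1"
  then obtain S T where ST: "fair S" "x = win_vector S P" "fair T" "y = win_vector T P" by blast
  have u: "u \<le> 1" "v = 1 - u" using uv by auto
  have "u *\<^sub>R x + v *\<^sub>R y = win_vector (Choose (map_pmf (\<lambda>b. if b then S else T) (bernoulli_pmf u))) P"
    by (simp add: vec_eq_iff win_vector_def ST win_prob_Choose_bernoulli[OF uv(1) u(1)] u(2) del: winner_pmf.simps)
  then show "u *\<^sub>R x + v *\<^sub>R y \<in> {win_vector T P |T. fair T}"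
    using fair_mixture[OF ST(1,3) uv(1) u(1)] by blast
qed

lemma num_matches_map_prod:
  assumes "bij \<tau>"
  shows "num_matches (map (map_prod \<tau> \<tau>) ms) (\<tau> a) (\<tau> b) = num_matches ms a b"
proof -
  have "(map_prod \<tau> \<tau> m = (\<tau> a, \<tau> b) \<or> map_prod \<tau> \<tau> m = (\<tau> b, \<tau> a)) = (m = (a, b) \<or> m = (b, a))" for m
    using assms by (cases m) (auto simp: bij_def inj_eq)
  then show ?thesis by (simp add: num_matches_def filter_map comp_def)
qed

lemma num_matches_replicate: "num_matches (concat (replicate N ms)) a b = N * num_matches ms a b"
  by (induction N) (auto simp: num_matches_def)

lemma round_robin_exists:
  "\<exists>ms :: ('n::{finite,linorder} \<times> 'n) list. (\<forall>m\<in>set ms. fst m \<noteq> snd m) \<and>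
     (\<forall>a b. a \<noteq> b \<longrightarrow> num_matches ms a b = 1)"
proof -
  obtain ms where ms: "set ms = {(a::'n, b). a < b}" "distinct ms"
    using finite_distinct_list[OF finite] by blast
  have "num_matches ms a b = 1" if "a < b" for a b
  proof -
    have "num_matches ms a b = card (set (filter (\<lambda>m. m = (a, b) \<or> m = (b, a)) ms))"
      unfolding num_matches_def by (rule distinct_card[OF distinct_filter[OF ms(2)], symmetric])
    also have "set (filter (\<lambda>m. m = (a, b) \<or> m = (b, a)) ms) = {(a, b)}" using ms(1) that by auto
    finally show ?thesis by simp
  qed
  moreover have "num_matches ms a b = num_matches ms b a" for a b
    unfolding num_matches_def by (simp add: disj_commute)
  ultimately have "num_matches ms a b = 1" if "a \<noteq> b" for a b
    using that by (metis linorder_neqE)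
  then show ?thesis using ms(1) by (intro exI[of _ ms]) auto
qed

lemma average_close:
  fixes f :: "'a \<Rightarrow> real"
  assumes "finite A" "A \<noteq> {}" "\<And>x. x \<in> A \<Longrightarrow> \<bar>f x - v\<bar> \<le> B"
  shows "\<bar>(\<Sum>x\<in>A. f x) / card A - v\<bar> \<le> B"
proof -
  have c: "real (card A) > 0" using assms by (simp add: card_gt_0_iff)
  have "(\<Sum>x\<in>A. f x) / card A - v = (\<Sum>x\<in>A. f x - v) / card A"
    using c by (simp add: sum_subtractf diff_divide_distrib)
  also have "\<bar>\<dots>\<bar> \<le> (\<Sum>x\<in>A. \<bar>f x - v\<bar>) / card A"
    using c sum_abs[of "\<lambda>x. f x - v" A] by (simp add: abs_div divide_right_mono)
  also have "\<dots> \<le> (\<Sum>x\<in>A. B) / card A" using c assms(3) by (intro divide_right_mono sum_mono) auto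
  also have "\<dots> = B" using c by simp
  finally show ?thesis .
qed

section \<open>From digraphs to limits of win vectors\<close>

lemma digraph_multiplicity:
  fixes G :: "('n::{finite,linorder}, nat) pre_digraph"
  assumes G: "G \<in> two_out_digraphs"
  defines "\<mu> \<equiv> \<lambda>r s. card {e \<in> arcs G. tail G e = r \<and> head G e = s}"
  shows "(\<Sum>s\<in>UNIV. \<mu> r s) = 2"
    and "\<mu> r s > 0 \<Longrightarrow> s \<le> r"
    and "\<mu> r s \<ge> 2 \<Longrightarrow> s = Min UNIV \<or> s = r"
    and "(\<Sum>r\<in>UNIV. \<mu> r s) = in_degree G s"
proof -
  have fin: "finite (arcs G)" and out: "out_degree G r = 2"
    and down: "\<And>e. e \<in> arcs G \<Longrightarrow> head G e \<le> tail G e"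
    and rule3: "\<And>i e e'. e \<in> out_arcs G i \<Longrightarrow> e' \<in> out_arcs G i \<Longrightarrow> e \<noteq> e' \<Longrightarrow> head G e = head G e' \<Longrightarrow>
          head G e = Min UNIV \<or> head G e = i"
    using G by (auto simp: two_out_digraphs_def fin_digraph_def fin_digraph_axioms_def)
  have "(\<Sum>s\<in>UNIV. \<mu> r s) = card (\<Union>s. {e \<in> arcs G. tail G e = r \<and> head G e = s})"
    unfolding \<mu>_def using fin by (subst card_UN_disjoint) auto
  also have "(\<Union>s. {e \<in> arcs G. tail G e = r \<and> head G e = s}) = out_arcs G r" by (auto simp: out_arcs_def)
  finally show "(\<Sum>s\<in>UNIV. \<mu> r s) = 2" using out by (simp add: out_degree_def)
  have "(\<Sum>r\<in>UNIV. \<mu> r s) = card (\<Union>r. {e \<in> arcs G. tail G e = r \<and> head G e = s})"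
    unfolding \<mu>_def using fin by (subst card_UN_disjoint) auto
  also have "(\<Union>r. {e \<in> arcs G. tail G e = r \<and> head G e = s}) = in_arcs G s" by (auto simp: in_arcs_def)
  finally show "(\<Sum>r\<in>UNIV. \<mu> r s) = in_degree G s" by (simp add: in_degree_def)
  show "s \<le> r" if "\<mu> r s > 0"
    using that down unfolding \<mu>_def card_gt_0_iff by blast
  show "s = Min UNIV \<or> s = r" if ge: "\<mu> r s \<ge> 2"
  proof -
    obtain T where "T \<subseteq> {e \<in> arcs G. tail G e = r \<and> head G e = s}" "card T = 2"
      by (rule obtain_subset_with_card_n[OF ge[unfolded \<mu>_def]])
    then obtain e e' where "e \<noteq> e'" "e \<in> out_arcs G r" "e' \<in> out_arcs G r" "head G e = s" "head G e' = s"
      unfolding card_2_iff by (auto simp: out_arcs_def)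
    then show ?thesis using rule3[of e r e'] by simp
  qed
qed

lemma digraph_vector_in_closure:
  fixes G :: "('n::{finite,linorder}, nat) pre_digraph"
  assumes G: "G \<in> two_out_digraphs"
  shows "digraph_vector G \<in> closure {win_vector T wt_matrix | T. fair T}"
proof -
  define \<mu> where "\<mu> = (\<lambda>r s. card {e \<in> arcs G. tail G e = r \<and> head G e = s})"
  have \<mu>: "(\<Sum>s\<in>UNIV. \<mu> r s) = 2" "\<mu> r s > 0 \<Longrightarrow> s \<le> r" "\<mu> r s \<ge> 2 \<Longrightarrow> s = Min UNIV \<or> s = r"
    "(\<Sum>r\<in>UNIV. \<mu> r s) = in_degree G s" for r s
    unfolding \<mu>_def
    by (rule digraph_multiplicity(1)[OF G], erule digraph_multiplicity(2)[OF G],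
        erule digraph_multiplicity(3)[OF G], rule digraph_multiplicity(4)[OF G])
  have target: "digraph_vector G $ k = pmf (transfer_rule \<mu> wt) k" for k
    using pmf_transfer_rule_wt[of \<mu> k, OF \<mu>(1-3)] \<mu>(4)[where s = k]
    by (simp add: digraph_vector_def flip: of_nat_sum)
  obtain ms :: "('n \<times> 'n) list" where ms: "\<And>m. m \<in> set ms \<Longrightarrow> fst m \<noteq> snd m"
    "\<And>a b. a \<noteq> b \<Longrightarrow> num_matches ms a b = 1"
    using round_robin_exists by blast
  define D where "D = (real CARD('n))\<^sup>2 / (4 * (scale TYPE('n))\<^sup>2)"
  \<comment> \<open>\<open>Suc N\<close> rounds, so that the unit of rounding is positive for every
    index.\<close>
  define X where "X = (\<lambda>N. win_vector (shuffled
      (\<lambda>d. transfer_rule \<mu> (round_diff (2 * scale TYPE('n) * real (Suc N)) d)) (concat (replicate (Suc N) ms))) wt_matrix)"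
  have ms_ne: "fst m \<noteq> snd m" if "m \<in> set (concat (replicate (Suc N) ms))" for m N
    using that ms(1) by (auto split: if_splits)
  have mem: "X N \<in> {win_vector T wt_matrix | T. fair T}" for N
  proof -
    let ?t = "2 * scale TYPE('n) * real (Suc N)"
    have "monotone_rule (\<lambda>d. transfer_rule \<mu> (round_diff ?t d))"
      by (rule monotone_transfer_rule[OF \<mu>(1)]) (use \<mu>(2,3) scale_pos[where 'n = 'n] in simp_all)
    moreover have "equivariant_rule (\<lambda>d. transfer_rule \<mu> (round_diff ?t d))"
      by (rule equivariant_transfer_rule[OF \<mu>(1)]) (use \<mu>(2,3) in simp_all)
    ultimately have "fair (shuffled (\<lambda>d. transfer_rule \<mu> (round_diff ?t d)) (concat (replicate (Suc N) ms)))"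
      unfolding fair_def by (intro conjI shuffled_fair ms_ne)
    then show ?thesis unfolding X_def by blast
  qed
  have close: "\<bar>X N $ k - digraph_vector G $ k\<bar> \<le> D * inverse (real (Suc N))" for N k
  proof -
    let ?E = "\<lambda>d. transfer_rule \<mu> (round_diff (2 * scale TYPE('n) * real (Suc N)) d)"
    let ?ms = "concat (replicate (Suc N) ms)"
    have "\<bar>(\<Sum>\<tau> | bij \<tau>. win_prob (play_all ?E (map (map_prod \<tau> \<tau>) ?ms) (\<lambda>_ _. 0)) wt_matrix k) /
        card {\<tau> :: 'n \<Rightarrow> 'n. bij \<tau>} - digraph_vector G $ k\<bar> \<le> D * inverse (real (Suc N))"
    \<comment> \<open>Every relabeled schedule still has \<open>Suc N\<close> matches per pair, so
      one bound holds for all relabelings and hence for their average.\<close>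
    proof (rule average_close[OF bij_set])
      fix \<tau> :: "'n \<Rightarrow> 'n" assume "\<tau> \<in> {\<tau>. bij \<tau>}"
      then have \<tau>: "bij \<tau>" by simp
      have 1: "fst m \<noteq> snd m" if m: "m \<in> set (map (map_prod \<tau> \<tau>) ?ms)" for m
      proof -
        have "m \<in> map_prod \<tau> \<tau> ` set ?ms" using m by (simp only: set_map)
        then obtain m' where "m = map_prod \<tau> \<tau> m'" "m' \<in> set ?ms" by (rule imageE)
        then show ?thesis using ms_ne[of m' N] \<tau> by (auto simp: bij_def inj_eq)
      qed
      have 2: "num_matches (map (map_prod \<tau> \<tau>) ?ms) a b = Suc N" if "a \<noteq> b" for a b
      proof -
        obtain a' b' where ab: "a = \<tau> a'" "b = \<tau> b'" using \<tau> by (metis bij_pointE)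
        have "num_matches (map (map_prod \<tau> \<tau>) ?ms) a b = num_matches ?ms a' b'"
          unfolding ab by (rule num_matches_map_prod[OF \<tau>])
        also have "\<dots> = Suc N * num_matches ms a' b'" by (rule num_matches_replicate)
        also have "num_matches ms a' b' = 1" by (rule ms(2)) (use ab that in blast)
        finally show ?thesis by simp
      qed
      have "\<bar>win_prob (play_all ?E (map (map_prod \<tau> \<tau>) ?ms) (\<lambda>_ _. 0)) wt_matrix k - digraph_vector G $ k\<bar>
          \<le> (real CARD('n))\<^sup>2 / (4 * (scale TYPE('n))\<^sup>2 * real (Suc N))"
        unfolding target by (rule win_prob_transfer_rule[OF \<mu>(1-3) _ 1 2]) (assumption | simp)+
      then show "\<bar>win_prob (play_all ?E (map (map_prod \<tau> \<tau>) ?ms) (\<lambda>_ _. 0)) wt_matrix k - digraph_vector G $ k\<bar>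
          \<le> D * inverse (real (Suc N))"
        unfolding D_def by (simp only: divide_inverse inverse_mult_distrib mult.assoc)
    qed
    then show ?thesis unfolding X_def win_vector_def win_prob_shuffled by simp
  qed
  have "(\<lambda>N. X N $ k) \<longlonglongrightarrow> digraph_vector G $ k" for k
  proof -
    have "(\<lambda>N. D * inverse (real (Suc N))) \<longlonglongrightarrow> 0"
      using tendsto_mult_left[OF LIMSEQ_inverse_real_of_nat, of D] unfolding mult_zero_right .
    moreover have "\<forall>\<^sub>F N in sequentially. norm (X N $ k - digraph_vector G $ k) \<le> D * inverse (real (Suc N))"
      unfolding real_norm_def using close by (intro always_eventually allI)
    ultimately have "(\<lambda>N. X N $ k - digraph_vector G $ k) \<longlonglongrightarrow> 0"
      by (rule Lim_null_comparison[rotated])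
    then show ?thesis by (rule LIM_zero_cancel)
  qed
  then have "X \<longlonglongrightarrow> digraph_vector G" by (rule vec_tendstoI)
  then show ?thesis unfolding closure_sequential using mem by blast
qed

theorem theorem4p3:
  shows "(digraph_hull :: (real ^ 'n::{finite,linorder}) set) \<subseteq> achievable"
proof -
  let ?W = "{win_vector T (wt_matrix :: ((real, 'n) vec, 'n) vec) | T. fair T}"
  have "digraph_hull \<subseteq> closure ?W"
    unfolding digraph_hull_def
    by (intro hull_minimal convex_closure convex_win_vectors image_subsetI digraph_vector_in_closure)
  also have "\<dots> \<subseteq> achievable"
    unfolding achievable_def fair_def
    by (intro closure_mono) (use wt_matrix_doubly_monotonic in blast)
  finally show ?thesis .
qed

end
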